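(* If $p_\gamma=0$ (piecewise constant polynomials in time), then the linear system for the viscous terms $$\Big(\overline{M}_i-\nu\sum_{j\in S_i}\mathcal{D}_{i,j}\overline{M}_j^{-1}\mathcal{Q}_{i,j}\Big)\bar v_i-\nu\sum_{j\in S_i}\mathcal{D}_{i,j}\overline{M}_j^{-1}\mathcal{Q}_{\wp(i,j),j}\,\bar v_{\wp(i,j)}=b_i,\qquad i=1,\dots,N_e,$$ in which the unknowns, for each velocity component, are the coefficient vectors $\bar v_i\in\mathbb{R}^{N_\phi}$, $i=1,\dots,N_e$, and the $b_i$ are known right-hand sides, is symmetric, i.e. its coefficient matrix (a real $N_eN_\phi\times N_eN_\phi$ matrix) is symmetric. Mesh, basis functions and the matrices $\overline{M}_i,\overline{M}_j,\mathcal{D}_{i,j},\mathcal{Q}_{i,j}$ are defined in the context.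
   Context: The system comes from a staggered space-time discontinuous Galerkin discretization of the 3D incompressible Navier-Stokes equations; $\nu$ is the (constant) kinematic viscosity coefficient, and $b_i$ collects known data (the velocity of the previous time step and the convective terms evaluated at the previous Picard iterate). Mesh. $\Omega\subset\mathbb{R}^3$ is covered by non-overlapping, possibly curved, tetrahedral elements $T_1,\dots,T_{N_e}$. The reference tetrahedron is $T_{ref}=\{(\xi,\eta,\zeta)\in\mathbb{R}^3:\xi,\eta,\zeta\ge0,\ \xi+\eta+\zeta\le1\}$, and $F_i:T_i\to T_{ref}$ is the invertible map from physical to reference coordinates. The faces are $\Gamma_1,\dots,\Gamma_{N_d}$, and $S_i$ is the set of the four indices $j$ such that $\Gamma_j$ is a face of $T_i$. The system is written with a neighbour across each face: for every $i$ and $j\in S_i$, $\wp(i,j)$ is the index of the neighbouring tetrahedron sharing $\Gamma_j$ with $T_i$. Of the two tetrahedra sharing $\Gamma_j$ one is arbitrarily called left, $T_{\ell(j)}$, and the other right, $T_{r(j)}$; $\vec n_j$ is the unit normal on $\Gamma_j$ pointing from left to right. The dual element $H_j$ associated with $\Gamma_j$ is the five-point hexahedron determined by the barycenters of $T_{\ell(j)}$ and $T_{r(j)}$ and the three vertices of $\Gamma_j$; $T_{i,j}=H_j\cap T_i$ for $j\in S_i$, so that $H_j=T_{\ell(j),j}\cup T_{r(j),j}$. For $j\in S_i$, $\vec n_{ij}$ is the unit normal on $\Gamma_j$ pointing outward from $T_i$, and $\sigma_{i,j}=\frac{r(j)-2i+\ell(j)}{r(j)-\ell(j)}$, i.e.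 $\sigma_{i,j}=1$ if $i=\ell(j)$ and $\sigma_{i,j}=-1$ if $i=r(j)$. Time. One time step is the interval $[t^n,t^{n+1}]$, $\Delta t=t^{n+1}-t^n>0$. The superscript $st$ denotes the Cartesian product with $[t^n,t^{n+1}]$ (for $T_i$, $T_{i,j}$, $H_j$, $\Gamma_j$). Basis functions. $p$ is the polynomial degree in space and $p_\gamma$ that in time; $N_\phi=N_\psi=(p+1)(p+2)(p+3)/6$. On $T_{ref}$, $\{\phi_k\}_{k=1}^{N_\phi}$ is the Lagrange nodal basis of the polynomials of total degree $\le p$ for the nodes $(j_1/p,j_2/p,j_3/p)$, $j_1,j_2,j_3\ge0$, $j_1+j_2+j_3\le p$; on $T_i$, $\phi_k^{(i)}=\phi_k\circ F_i$. On $H_j$, $\{\psi_k^{(j)}\}_{k=1}^{N_\psi}$ are the scaled monomials $(x-x_0)^{k_1}(y-y_0)^{k_2}(z-z_0)^{k_3}/h_j^{k_1+k_2+k_3}$, $k_1,k_2,k_3\ge0$, $k_1+k_2+k_3\le p$, with $(x_0,y_0,z_0)$ the center of $H_j$ and $h_j>0$ a characteristic length of $H_j$. The time basis consists of the $p_\gamma+1$ Lagrange polynomials through the Gauss-Legendre points of $[0,1]$, transported to $[t^n,t^{n+1}]$ by $t=t^n+\tau\Delta t$. The space-time basis functions $\tilde\phi_k^{(i)}$, $\tilde\psi_k^{(j)}$ are the products of space and time basis functions. For $p_\gamma=0$ the only time basis function is the constant $1$, so $\tilde\phi_k^{(i)}=\phi_k^{(i)}$ and $\tilde\psi_k^{(j)}=\psi_k^{(j)}$.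 Matrices (entry $(k,l)$; $\nabla$ is the spatial gradient; index $i$ refers to main-grid elements, $j$ to dual elements): $$(\overline{M}_i)_{kl}=\int_{T_i}\tilde\phi_k^{(i)}(\mathbf{x},t^{n+1})\tilde\phi_l^{(i)}(\mathbf{x},t^{n+1})\,d\mathbf{x}-\int_{T_i^{st}}\frac{\partial\tilde\phi_k^{(i)}}{\partial t}\tilde\phi_l^{(i)}\,d\mathbf{x}\,dt,\qquad(\overline{M}_j)_{kl}=\int_{H_j^{st}}\tilde\psi_k^{(j)}\tilde\psi_l^{(j)}\,d\mathbf{x}\,dt,$$ and, with entries in $\mathbb{R}^3$, $$(\mathcal{D}_{i,j})_{kl}=\int_{\Gamma_j^{st}}\tilde\phi_k^{(i)}\tilde\psi_l^{(j)}\vec n_{ij}\,dS\,dt-\int_{T_{i,j}^{st}}\nabla\tilde\phi_k^{(i)}\,\tilde\psi_l^{(j)}\,d\mathbf{x}\,dt,$$ $$(\mathcal{Q}_{i,j})_{kl}=\int_{T_{i,j}^{st}}\tilde\psi_k^{(j)}\nabla\tilde\phi_l^{(i)}\,d\mathbf{x}\,dt-\int_{\Gamma_j^{st}}\tilde\psi_k^{(j)}\tilde\phi_l^{(i)}\,\sigma_{i,j}\vec n_j\,dS\,dt.$$ On $\Gamma_j$, $\tilde\phi^{(i)}$ denotes the trace from $T_i$. In products, $\mathbb{R}^3$-valued entries are multiplied by the Euclidean inner product: $(\mathcal{D}_{i,j}\overline{M}_j^{-1}\mathcal{Q}_{i',j})_{kl}=\sum_{a,b}(\overline{M}_j^{-1})_{ab}\,(\mathcal{D}_{i,j})_{ka}\cdot(\mathcal{Q}_{i',j})_{bl}$.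 *)

theory Defs
  imports
    "HOL-Analysis.Analysis"
    "HOL-Computational_Algebra.Polynomial"
    "Jordan_Normal_Form.Gauss_Jordan_Elimination"
begin

unbundle no vec_syntax

text \<open>Vectors and matrices of variable size are those of \<^theory>\<open>Jordan_Normal_Form.Matrix\<close>; the type
  \<^typ>\<open>real^3\<close> is used only for points of space. All indices start at 0.\<close>


subsection \<open>Calculus in space\<close>

definition gradient :: "(real^3 \<Rightarrow> real) \<Rightarrow> real^3 \<Rightarrow> real^3" where
  "gradient f x = vec_lambda (\<lambda>k. frechet_derivative f (at x) (axis k 1))"

definition unit_triangle :: "(real \<times> real) set" where
  "unit_triangle = {(s, r). 0 \<le> s \<and> 0 \<le> r \<and> s + r \<le> 1}"

definition area_element :: "(real \<times> real \<Rightarrow> real^3) \<Rightarrow> real \<times> real \<Rightarrow> real" where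
  "area_element \<gamma> = (\<lambda>(s, r). norm (cross3 (vector_derivative (\<lambda>s'. \<gamma> (s', r)) (at s))
                                             (vector_derivative (\<lambda>r'. \<gamma> (s, r')) (at r))))"

text \<open>The integral of \<open>g x t\<close> with respect to \<open>dS dt\<close> over the product of the surface
  \<open>\<gamma> ` unit_triangle\<close> with the time interval \<open>[t0, t1]\<close>.\<close>

definition surface_time_integral ::
    "(real \<times> real \<Rightarrow> real^3) \<Rightarrow> real \<Rightarrow> real \<Rightarrow> (real^3 \<Rightarrow> real \<Rightarrow> 'b::euclidean_space) \<Rightarrow> 'b" where
  "surface_time_integral \<gamma> t0 t1 g =
     (LINT z:unit_triangle \<times> {t0..t1}|lborel. area_element \<gamma> (fst z) *\<^sub>R g (\<gamma> (fst z)) (snd z))"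

definition volume_time_integral ::
    "(real^3) set \<Rightarrow> real \<Rightarrow> real \<Rightarrow> (real^3 \<Rightarrow> real \<Rightarrow> 'b::euclidean_space) \<Rightarrow> 'b" where
  "volume_time_integral A t0 t1 g = (LINT z:A \<times> {t0..t1}|lborel. g (fst z) (snd z))"


subsection \<open>The reference tetrahedron\<close>

definition ref_tet :: "(real^3) set" where
  "ref_tet = {x. vec_nth x 1 \<ge> 0 \<and> vec_nth x 2 \<ge> 0 \<and> vec_nth x 3 \<ge> 0
                 \<and> vec_nth x 1 + vec_nth x 2 + vec_nth x 3 \<le> 1}"

definition ref_vertex :: "nat \<Rightarrow> real^3" where
  "ref_vertex = (!) [vector [0, 0, 0], vector [1, 0, 0], vector [0, 1, 0], vector [0, 0, 1]]"

definition barycentric :: "nat \<Rightarrow> real^3 \<Rightarrow> real" where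
  "barycentric f x = [1 - vec_nth x 1 - vec_nth x 2 - vec_nth x 3,
                      vec_nth x 1, vec_nth x 2, vec_nth x 3] ! f"

text \<open>Face \<open>f < 4\<close> is the one opposite to vertex \<open>f\<close>.\<close>

definition ref_face :: "nat \<Rightarrow> (real^3) set" where
  "ref_face f = {x \<in> ref_tet. barycentric f x = 0}"

definition ref_face_param :: "nat \<Rightarrow> real \<times> real \<Rightarrow> real^3" where
  "ref_face_param f = (\<lambda>(s, r).
     let vs = map ref_vertex (filter (\<lambda>g. g \<noteq> f) [0..<4])
     in vs ! 0 + s *\<^sub>R (vs ! 1 - vs ! 0) + r *\<^sub>R (vs ! 2 - vs ! 0))"

definition ref_barycenter :: "real^3" where
  "ref_barycenter = (1/4) *\<^sub>R (\<Sum>v<4. ref_vertex v)"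

text \<open>The tetrahedron spanned by the barycenter and face \<open>f\<close>.\<close>

definition ref_subtet :: "nat \<Rightarrow> (real^3) set" where
  "ref_subtet f = convex hull (insert ref_barycenter (ref_vertex ` ({..<4} - {f})))"


subsection \<open>Meshes and discretizations\<close>

text \<open>No finite family of non-overlapping compact tetrahedra in space has a neighbour across every
  face unless opposite sides of the domain are identified. Face \<open>j\<close> therefore carries a translation
  \<open>shift j\<close>, which is 0 for an ordinary common face: across face \<open>j\<close> the element \<open>left_elem j\<close> meets
  the translate by \<open>shift j\<close> of the element \<open>right_elem j\<close>. The sets \<open>face j\<close> and \<open>dual_elem j\<close> are
  located at the left element.

  The centers and characteristic lengths of the dual elements are arbitrary data.\<close>

record discretization =
  num_elems :: nat
  num_faces :: nat
  elem :: "nat \<Rightarrow> (real^3) set"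
  ref_map :: "nat \<Rightarrow> real^3 \<Rightarrow> real^3"
  face :: "nat \<Rightarrow> (real^3) set"
  left_elem :: "nat \<Rightarrow> nat"
  right_elem :: "nat \<Rightarrow> nat"
  shift :: "nat \<Rightarrow> real^3"
  dual_center :: "nat \<Rightarrow> real^3"
  dual_length :: "nat \<Rightarrow> real"
  deg_space :: nat
  deg_time :: nat
  t_old :: real
  t_new :: real

definition offset :: "discretization \<Rightarrow> nat \<Rightarrow> nat \<Rightarrow> real^3" where
  "offset d i j = (if i = right_elem d j then shift d j else 0)"

text \<open>The copy of element \<open>i\<close> that is adjacent to face \<open>j\<close>, its map to the reference tetrahedron
  and its faces. With zero shifts these are element \<open>i\<close>, its map and its faces.\<close>

definition elem_at :: "discretization \<Rightarrow> nat \<Rightarrow> nat \<Rightarrow> (real^3) set" where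
  "elem_at d i j = (\<lambda>x. x + offset d i j) ` elem d i"

definition ref_map_at :: "discretization \<Rightarrow> nat \<Rightarrow> nat \<Rightarrow> real^3 \<Rightarrow> real^3" where
  "ref_map_at d i j x = ref_map d i (x - offset d i j)"

definition elem_face_at :: "discretization \<Rightarrow> nat \<Rightarrow> nat \<Rightarrow> nat \<Rightarrow> (real^3) set" where
  "elem_face_at d i j f = {x \<in> elem_at d i j. ref_map_at d i j x \<in> ref_face f}"

text \<open>The index set \<open>S\<^sub>i\<close>.\<close>

definition faces_of :: "discretization \<Rightarrow> nat \<Rightarrow> nat set" where
  "faces_of d i = {j. j < num_faces d \<and> (\<exists>f<4. face d j = elem_face_at d i j f)}"

definition local_face :: "discretization \<Rightarrow> nat \<Rightarrow> nat \<Rightarrow> nat" where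
  "local_face d i j = (THE f. f < 4 \<and> face d j = elem_face_at d i j f)"

definition neighbour :: "discretization \<Rightarrow> nat \<Rightarrow> nat \<Rightarrow> nat" where
  "neighbour d i j = (if i = left_elem d j then right_elem d j else left_elem d j)"

definition regular_tetrahedron :: "(real^3) set \<Rightarrow> (real^3 \<Rightarrow> real^3) \<Rightarrow> bool" where
  "regular_tetrahedron T F \<longleftrightarrow> F ` T = ref_tet \<and>
     (\<exists>U. open U \<and> T \<subseteq> U \<and> inj_on F U \<and> (\<forall>x\<in>U. F differentiable (at x)) \<and>
          (\<forall>v. continuous_on U (\<lambda>x. frechet_derivative F (at x) v)) \<and>
          (\<forall>x\<in>U. inj (frechet_derivative F (at x))))"

definition valid_mesh :: "discretization \<Rightarrow> bool" where
  "valid_mesh d \<longleftrightarrow>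
     (\<forall>i<num_elems d. regular_tetrahedron (elem d i) (ref_map d i)) \<and>
     (\<forall>i<num_elems d. \<forall>i'<num_elems d. i \<noteq> i' \<longrightarrow> interior (elem d i) \<inter> interior (elem d i') = {}) \<and>
     (\<forall>i<num_elems d. \<forall>f<4. \<exists>!j. j < num_faces d \<and> face d j = elem_face_at d i j f) \<and>
     (\<forall>j<num_faces d.
        left_elem d j < num_elems d \<and> right_elem d j < num_elems d \<and> left_elem d j \<noteq> right_elem d j \<and>
        (\<forall>i<num_elems d. j \<in> faces_of d i \<longleftrightarrow> i = left_elem d j \<or> i = right_elem d j) \<and>
        interior (elem_at d (left_elem d j) j) \<inter> interior (elem_at d (right_elem d j) j) = {} \<and>
        dual_length d j > 0)"

text \<open>The five-point hexahedron over face \<open>j\<close>, cut into its two parts on either side of the face.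
  If the maps \<open>ref_map\<close> are affine, it is the union of two straight tetrahedra, each the convex hull
  of the three vertices of the face and the barycenter of one of the two elements; for curved
  elements, barycenter and hexahedron are transported by the maps to the reference tetrahedron.\<close>

definition dual_elem :: "discretization \<Rightarrow> nat \<Rightarrow> (real^3) set" where
  "dual_elem d j = (\<Union>i\<in>{left_elem d j, right_elem d j}.
     {x \<in> elem_at d i j. ref_map_at d i j x \<in> ref_subtet (local_face d i j)})"

text \<open>The sets \<open>T\<^sub>i\<^sub>,\<^sub>j\<close>.\<close>

definition sub_elem :: "discretization \<Rightarrow> nat \<Rightarrow> nat \<Rightarrow> (real^3) set" where
  "sub_elem d i j = dual_elem d j \<inter> elem_at d i j"

definition face_param :: "discretization \<Rightarrow> nat \<Rightarrow> real \<times> real \<Rightarrow> real^3" where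
  "face_param d j u = (let i = left_elem d j in
     inv_into (elem_at d i j) (ref_map_at d i j) (ref_face_param (local_face d i j) u))"

text \<open>Inside the element the barycentric coordinate that vanishes on the face is positive, so minus
  its gradient points outward.\<close>

definition outward_normal :: "discretization \<Rightarrow> nat \<Rightarrow> nat \<Rightarrow> real^3 \<Rightarrow> real^3" where
  "outward_normal d i j x =
     - sgn (gradient (\<lambda>y. barycentric (local_face d i j) (ref_map_at d i j y)) x)"

definition face_normal :: "discretization \<Rightarrow> nat \<Rightarrow> real^3 \<Rightarrow> real^3" where
  "face_normal d j = outward_normal d (left_elem d j) j"

definition side_sign :: "discretization \<Rightarrow> nat \<Rightarrow> nat \<Rightarrow> real" where
  "side_sign d i j = (real (right_elem d j) - 2 * real i + real (left_elem d j))
                     / (real (right_elem d j) - real (left_elem d j))"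


subsection \<open>Basis functions\<close>

definition multi_indices :: "nat \<Rightarrow> (nat \<times> nat \<times> nat) list" where
  "multi_indices p = [(a, b, c). a \<leftarrow> [0..<p+1], b \<leftarrow> [0..<p+1-a], c \<leftarrow> [0..<p+1-a-b]]"

definition num_basis :: "nat \<Rightarrow> nat" where
  "num_basis p = (p + 1) * (p + 2) * (p + 3) div 6"

fun monomial :: "nat \<times> nat \<times> nat \<Rightarrow> real^3 \<Rightarrow> real" where
  "monomial (a, b, c) x = vec_nth x 1 ^ a * vec_nth x 2 ^ b * vec_nth x 3 ^ c"

fun total_degree :: "nat \<times> nat \<times> nat \<Rightarrow> nat" where
  "total_degree (a, b, c) = a + b + c"

definition poly_space :: "nat \<Rightarrow> (real^3 \<Rightarrow> real) set" where
  "poly_space p = {f. \<exists>c. f = (\<lambda>x. \<Sum>\<alpha>\<in>{\<alpha>. total_degree \<alpha> \<le> p}. c \<alpha> * monomial \<alpha> x)}"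

text \<open>For \<open>p = 0\<close> the only node is the origin, because division by 0 yields 0.\<close>

fun lagrange_node :: "nat \<Rightarrow> nat \<times> nat \<times> nat \<Rightarrow> real^3" where
  "lagrange_node p (a, b, c) = vector [real a / real p, real b / real p, real c / real p]"

definition ref_basis :: "nat \<Rightarrow> nat \<Rightarrow> real^3 \<Rightarrow> real" where
  "ref_basis p k = (THE f. f \<in> poly_space p \<and>
     (\<forall>l<num_basis p. f (lagrange_node p (multi_indices p ! l)) = (if l = k then 1 else 0)))"

definition phi :: "discretization \<Rightarrow> nat \<Rightarrow> nat \<Rightarrow> real^3 \<Rightarrow> real" where
  "phi d i k x = ref_basis (deg_space d) k (ref_map d i x)"

definition psi :: "discretization \<Rightarrow> nat \<Rightarrow> nat \<Rightarrow> real^3 \<Rightarrow> real" where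
  "psi d j k x = (let \<alpha> = multi_indices (deg_space d) ! k in
     monomial \<alpha> (x - dual_center d j) / dual_length d j ^ total_degree \<alpha>)"

text \<open>By Rodrigues' formula, the following polynomial is, up to a constant factor, the Legendre
  polynomial of degree \<open>n\<close> transported from \<open>[-1, 1]\<close> to \<open>[0, 1]\<close>.\<close>

definition shifted_legendre :: "nat \<Rightarrow> real poly" where
  "shifted_legendre n = (pderiv ^^ n) ([:0, 1:] ^ n * [:1, -1:] ^ n)"

definition gauss_points :: "nat \<Rightarrow> real list" where
  "gauss_points n = sorted_list_of_set {\<tau>. poly (shifted_legendre n) \<tau> = 0}"

definition time_basis :: "nat \<Rightarrow> nat \<Rightarrow> real \<Rightarrow> real" where
  "time_basis q m \<tau> = (\<Prod>m'\<in>{..q} - {m}. (\<tau> - gauss_points (q + 1) ! m')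
                                        / (gauss_points (q + 1) ! m - gauss_points (q + 1) ! m'))"

definition num_dofs :: "discretization \<Rightarrow> nat" where
  "num_dofs d = num_basis (deg_space d) * (deg_time d + 1)"

text \<open>The space-time index \<open>k < num_dofs d\<close> encodes the pair of the space index
  \<open>k mod num_basis\<close> and the time index \<open>k div num_basis\<close>.\<close>

definition time_factor :: "discretization \<Rightarrow> nat \<Rightarrow> real \<Rightarrow> real" where
  "time_factor d k t =
     time_basis (deg_time d) (k div num_basis (deg_space d)) ((t - t_old d) / (t_new d - t_old d))"

definition phi_st :: "discretization \<Rightarrow> nat \<Rightarrow> nat \<Rightarrow> real^3 \<Rightarrow> real \<Rightarrow> real" where
  "phi_st d i k x t = phi d i (k mod num_basis (deg_space d)) x * time_factor d k t"

definition psi_st :: "discretization \<Rightarrow> nat \<Rightarrow> nat \<Rightarrow> real^3 \<Rightarrow> real \<Rightarrow> real" where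
  "psi_st d j k x t = psi d j (k mod num_basis (deg_space d)) x * time_factor d k t"

definition phi_st_at :: "discretization \<Rightarrow> nat \<Rightarrow> nat \<Rightarrow> nat \<Rightarrow> real^3 \<Rightarrow> real \<Rightarrow> real" where
  "phi_st_at d i j k x t = phi_st d i k (x - offset d i j) t"


subsection \<open>Matrices\<close>

definition M_elem :: "discretization \<Rightarrow> nat \<Rightarrow> real mat" where
  "M_elem d i = mat (num_dofs d) (num_dofs d) (\<lambda>(k, l).
     (LINT x:elem d i|lborel. phi_st d i k x (t_new d) * phi_st d i l x (t_new d))
     - volume_time_integral (elem d i) (t_old d) (t_new d)
         (\<lambda>x t. deriv (\<lambda>s. phi_st d i k x s) t * phi_st d i l x t))"

definition M_dual :: "discretization \<Rightarrow> nat \<Rightarrow> real mat" where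
  "M_dual d j = mat (num_dofs d) (num_dofs d) (\<lambda>(k, l).
     volume_time_integral (dual_elem d j) (t_old d) (t_new d)
       (\<lambda>x t. psi_st d j k x t * psi_st d j l x t))"

definition D_mat :: "discretization \<Rightarrow> nat \<Rightarrow> nat \<Rightarrow> (real^3) mat" where
  "D_mat d i j = mat (num_dofs d) (num_dofs d) (\<lambda>(k, l).
     surface_time_integral (face_param d j) (t_old d) (t_new d)
       (\<lambda>x t. (phi_st_at d i j k x t * psi_st d j l x t) *\<^sub>R outward_normal d i j x)
     - volume_time_integral (sub_elem d i j) (t_old d) (t_new d)
       (\<lambda>x t. psi_st d j l x t *\<^sub>R gradient (\<lambda>y. phi_st_at d i j k y t) x))"

definition Q_mat :: "discretization \<Rightarrow> nat \<Rightarrow> nat \<Rightarrow> (real^3) mat" where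
  "Q_mat d i j = mat (num_dofs d) (num_dofs d) (\<lambda>(k, l).
     volume_time_integral (sub_elem d i j) (t_old d) (t_new d)
       (\<lambda>x t. psi_st d j k x t *\<^sub>R gradient (\<lambda>y. phi_st_at d i j l y t) x)
     - surface_time_integral (face_param d j) (t_old d) (t_new d)
       (\<lambda>x t. (psi_st d j k x t * phi_st_at d i j l x t * side_sign d i j) *\<^sub>R face_normal d j x))"

definition DMQ :: "discretization \<Rightarrow> nat \<Rightarrow> nat \<Rightarrow> nat \<Rightarrow> real mat" where
  "DMQ d i j i' = mat (num_dofs d) (num_dofs d) (\<lambda>(k, l).
     \<Sum>a<num_dofs d. \<Sum>b<num_dofs d.
       the (mat_inverse (M_dual d j)) $$ (a, b) * (D_mat d i j $$ (k, a) \<bullet> Q_mat d i' j $$ (b, l)))"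


subsection \<open>The viscous system\<close>

definition diagonal_block :: "discretization \<Rightarrow> real \<Rightarrow> nat \<Rightarrow> real mat" where
  "diagonal_block d \<nu> i = mat (num_dofs d) (num_dofs d) (\<lambda>(k, l).
     M_elem d i $$ (k, l) - \<nu> * (\<Sum>j\<in>faces_of d i. DMQ d i j i $$ (k, l)))"

definition viscous_lhs :: "discretization \<Rightarrow> real \<Rightarrow> (nat \<Rightarrow> real vec) \<Rightarrow> nat \<Rightarrow> real vec" where
  "viscous_lhs d \<nu> v i = diagonal_block d \<nu> i *\<^sub>v v i
     - vec (num_dofs d) (\<lambda>k. \<nu> * (\<Sum>j\<in>faces_of d i.
         (DMQ d i j (neighbour d i j) *\<^sub>v v (neighbour d i j)) $ k))"

definition viscous_system :: "discretization \<Rightarrow> real \<Rightarrow> (nat \<Rightarrow> real vec) \<Rightarrow> (nat \<Rightarrow> real vec) \<Rightarrow> bool" where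
  "viscous_system d \<nu> v b \<longleftrightarrow> (\<forall>i<num_elems d. viscous_lhs d \<nu> v i = b i)"

definition block_family :: "discretization \<Rightarrow> (nat \<Rightarrow> real vec) \<Rightarrow> bool" where
  "block_family d v \<longleftrightarrow> (\<forall>i<num_elems d. v i \<in> carrier_vec (num_dofs d))"

definition stack :: "discretization \<Rightarrow> (nat \<Rightarrow> real vec) \<Rightarrow> real vec" where
  "stack d v = vec (num_elems d * num_dofs d) (\<lambda>I. v (I div num_dofs d) $ (I mod num_dofs d))"

definition coefficient_matrix :: "discretization \<Rightarrow> real \<Rightarrow> real mat \<Rightarrow> bool" where
  "coefficient_matrix d \<nu> A \<longleftrightarrow>
     A \<in> carrier_mat (num_elems d * num_dofs d) (num_elems d * num_dofs d) \<and>
     (\<forall>v b. block_family d v \<longrightarrow> block_family d b \<longrightarrow>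
        (viscous_system d \<nu> v b \<longleftrightarrow> A *\<^sub>v stack d v = stack d b))"

end

(* For p_gamma = 0 the time basis is the constant 1, so M_i and M_j are symmetric: the time derivative
   in M_i vanishes, and M_j is a Gram matrix. The Gram matrix is also definite, because the dual element
   has interior points and a polynomial vanishing on an open set is zero; hence M_j has a symmetric
   inverse.

   The outward normals of the two tetrahedra sharing a face are opposite: otherwise some direction
   would enter both of them from a common relatively interior point of the face, although their
   interiors are disjoint; the other points of the face follow by continuity. Hence
   sigma_ij n_j = n_ij, and therefore D_ij = - Q_ij^T. Consequently
   (D_ij M_j^-1 Q_i'j)^T = D_i'j M_j^-1 Q_ij, and since j joins i to i' exactly if it joins i' to i,
   the assembled matrix is symmetric. *)
theory Submission
  imports
    Defs
    "Jordan_Normal_Form.Determinant"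
begin

subsection \<open>The reference tetrahedron\<close>

text \<open>The charts of the two elements at a face are unrelated: a point relatively interior to
  the face for one chart might lie on an edge for the other. The ray argument therefore runs only at
  points that are relatively interior for both, and density of these points has to be shown
  separately. \<open>elem_at\<close> replaces an element by the translate that touches the face, so
  faces identified by a shift are treated like ordinary ones once charts can be translated. The
  inverse mass matrix enters as \<open>the (mat_inverse ...)\<close>, of which nothing is known
  before the kernel of \<open>M_dual\<close> is shown to be trivial.
  \<open>coefficient_matrix\<close> describes a matrix only by its effect on stacked vectors. An
  explicit block matrix proves existence; since every vector is a stacked family, it is the only
  one, and its symmetry is that of any coefficient matrix.\<close>

lemma less_4_cases:
  assumes "f < (4::nat)"
  obtains "f = 0" | "f = 1" | "f = 2" | "f = 3"
proof -
  have "f = 0 \<or> f = 1 \<or> f = 2 \<or> f = 3"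
    using assms by arith
  then show thesis
    using that by blast
qed

lemma all_less_4: "(\<forall>f<(4::nat). P f) \<longleftrightarrow> P 0 \<and> P 1 \<and> P 2 \<and> P 3"
  by (auto elim!: less_4_cases)

lemma vec3_eq_iff:
  "(x::real^3) = y \<longleftrightarrow> vec_nth x 1 = vec_nth y 1 \<and> vec_nth x 2 = vec_nth y 2 \<and> vec_nth x 3 = vec_nth y 3"
  by (simp add: Finite_Cartesian_Product.vec_eq_iff forall_3)

text \<open>The constant gradient of the affine function \<open>barycentric f\<close>. By the chain
  rule it yields the gradient of that coordinate on a curved element.\<close>

definition barycentric_slope :: "nat \<Rightarrow> real^3" where
  "barycentric_slope f = [vector [-1, -1, -1], vector [1, 0, 0], vector [0, 1, 0], vector [0, 0, 1]] ! f"

lemma barycentric_simps: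
  "barycentric 0 x = 1 - vec_nth x 1 - vec_nth x 2 - vec_nth x 3"
  "barycentric (Suc 0) x = vec_nth x 1"
  "barycentric 2 x = vec_nth x 2"
  "barycentric 3 x = vec_nth x 3"
  by (simp_all add: barycentric_def)

lemma barycentric_eq:
  assumes "f < 4"
  shows "barycentric f x = barycentric f 0 + inner (barycentric_slope f) x"
  using assms
  by (cases rule: less_4_cases)
     (simp_all add: barycentric_simps barycentric_slope_def inner_vec_def sum_3)

lemma barycentric_slope_nonzero:
  assumes "f < 4"
  shows "barycentric_slope f \<noteq> 0"
  using assms
  by (cases rule: less_4_cases) (auto simp: barycentric_slope_def vec3_eq_iff)

lemma continuous_barycentric:
  assumes "f < 4"
  shows "continuous_on S (barycentric f)"
proof -
  have "barycentric f = (\<lambda>x. barycentric f 0 + inner (barycentric_slope f) x)"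
    using barycentric_eq[OF assms] by blast
  moreover have "continuous_on S (\<lambda>x. barycentric f 0 + inner (barycentric_slope f) x)"
    by (intro continuous_intros)
  ultimately show ?thesis
    by metis
qed

lemma barycentric_segment:
  assumes "f < 4"
  shows "barycentric f ((1 - t) *\<^sub>R x + t *\<^sub>R y) = (1 - t) * barycentric f x + t * barycentric f y"
  using assms
  by (cases rule: less_4_cases) (simp_all add: barycentric_simps algebra_simps)

lemma ref_tet_iff: "x \<in> ref_tet \<longleftrightarrow> (\<forall>f<4. 0 \<le> barycentric f x)"
  unfolding all_less_4 by (auto simp: barycentric_simps ref_tet_def)

lemma open_ref_tet_interior: "open {x. \<forall>f<4. 0 < barycentric f x}"
proof -
  have "{x. \<forall>f<4. 0 < barycentric f x} = (\<Inter>f\<in>{..<4}. {x. 0 < barycentric f x})"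
    by auto
  also have "open \<dots>"
    by (intro open_INT) (auto intro!: open_Collect_less continuous_barycentric)
  finally show ?thesis .
qed

lemma ref_faceI:
  assumes "barycentric f x = 0" and "\<And>g. g < 4 \<Longrightarrow> g \<noteq> f \<Longrightarrow> 0 < barycentric g x"
  shows "x \<in> ref_face f"
proof -
  have "0 \<le> barycentric g x" if "g < 4" for g
    using assms that by (cases "g = f") (auto intro: less_imp_le)
  then show ?thesis
    using assms(1) by (simp add: ref_face_def ref_tet_iff)
qed

lemma ref_face_centroid:
  assumes "f < 4"
  obtains m where "m \<in> ref_face f" "\<And>g. g < 4 \<Longrightarrow> g \<noteq> f \<Longrightarrow> 0 < barycentric g m"
proof -
  \<comment> \<open>For \<open>f = 0\<close> this is the centroid of the slanted face. Otherwise it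
    is the projection of (1/4, 1/4, 1/4) to a coordinate plane, with coordinates 1/2, 1/4, 1/4 at
    the vertices of the face.\<close>
  define m :: "real^3" where "m = vec_lambda (\<lambda>k. if f = 0 then 1/3 else 1/4) - (if f = 0 then 0 else (1/4) *\<^sub>R barycentric_slope f)"
  have "barycentric f m = 0 \<and> (\<forall>g<4. g \<noteq> f \<longrightarrow> 0 < barycentric g m)"
    unfolding all_less_4 using assms
    by (cases rule: less_4_cases) (simp_all add: m_def barycentric_simps barycentric_slope_def)
  then show thesis
    by (intro that[of m] ref_faceI) auto
qed

text \<open>Moving slightly from \<open>x\<close> towards a relatively interior point of the face
  mixes nonnegative coordinates with positive ones, so all coordinates other than \<open>f\<close>
  become positive.\<close>

lemma ref_face_dense_interior:
  assumes "f < 4" "x \<in> ref_face f" "0 < e"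
  obtains y where "y \<in> ref_face f" "dist x y < e" "\<And>g. g < 4 \<Longrightarrow> g \<noteq> f \<Longrightarrow> 0 < barycentric g y"
proof -
  obtain m where m: "m \<in> ref_face f" "\<And>g. g < 4 \<Longrightarrow> g \<noteq> f \<Longrightarrow> 0 < barycentric g m"
    using ref_face_centroid[OF assms(1)] by blast
  have "((\<lambda>t. (1 - t) *\<^sub>R x + t *\<^sub>R m) \<longlongrightarrow> (1 - 0) *\<^sub>R x + 0 *\<^sub>R m) (at_right 0)"
    by (intro tendsto_intros)
  then have "eventually (\<lambda>t. dist ((1 - t) *\<^sub>R x + t *\<^sub>R m) x < e) (at_right 0)"
    using \<open>0 < e\<close> by (auto simp: tendsto_iff)
  moreover have "eventually (\<lambda>t::real. 0 < t) (at_right 0)" "eventually (\<lambda>t::real. t < 1) (at_right 0)"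
    by (auto simp: eventually_at_right_less intro!: eventually_at_rightI[of 0 1])
  ultimately have "eventually (\<lambda>t. dist ((1 - t) *\<^sub>R x + t *\<^sub>R m) x < e \<and> 0 < t \<and> t < 1) (at_right 0)"
    by (intro eventually_conj)
  then obtain t where t: "dist ((1 - t) *\<^sub>R x + t *\<^sub>R m) x < e" "0 < t" "t < 1"
    using eventually_happens'[OF trivial_limit_at_right_real] by blast
  let ?y = "(1 - t) *\<^sub>R x + t *\<^sub>R m"
  have x: "\<And>g. g < 4 \<Longrightarrow> 0 \<le> barycentric g x" "barycentric f x = 0" "barycentric f m = 0"
    using assms m by (auto simp: ref_face_def ref_tet_iff)
  have pos: "0 < barycentric g ?y" if "g < 4" "g \<noteq> f" for g
    unfolding barycentric_segment[OF that(1)] using m(2)[OF that] x(1)[OF that(1)] t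
    by (intro add_nonneg_pos mult_nonneg_nonneg mult_pos_pos) auto
  have zero: "barycentric f ?y = 0"
    using x by (simp add: barycentric_segment[OF assms(1)])
  have "?y \<in> ref_face f"
    using zero pos by (rule ref_faceI)
  then show thesis
    using that[of ?y] pos t by (simp add: dist_commute)
qed

lemma sum_less_4: "(\<Sum>v<(4::nat). h v) = h 0 + h 1 + h 2 + (h 3 :: 'a::comm_monoid_add)"
  by (simp add: lessThan_nat_numeral lessThan_Suc ac_simps)

lemma ref_vertex_simps:
  "ref_vertex 0 = vector [0, 0, 0]" "ref_vertex (Suc 0) = vector [1, 0, 0]"
  "ref_vertex 2 = vector [0, 1, 0]" "ref_vertex 3 = vector [0, 0, 1]"
  by (simp_all add: ref_vertex_def)

lemma ref_barycenter_eq: "ref_barycenter = vector [1/4, 1/4, 1/4]"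
  by (simp add: ref_barycenter_def sum_less_4 ref_vertex_simps vec3_eq_iff)

text \<open>The barycenter cuts the tetrahedron into four parts, according to which coordinate is
  the smallest.\<close>

lemma ref_subtet_superset:
  assumes f: "f < 4" and pos: "0 < barycentric f x"
    and less: "\<And>g. g < 4 \<Longrightarrow> g \<noteq> f \<Longrightarrow> barycentric f x < barycentric g x"
  shows "x \<in> ref_subtet f"
proof -
  \<comment> \<open>The barycenter is a quarter of the sum of the vertices. Taking the amount
    \<open>barycentric f x\<close> away from every vertex therefore frees the weight
    \<open>4 * barycentric f x\<close> for the barycenter and leaves nothing at vertex
    \<open>f\<close>.\<close>
  define u where "u v = (if v = f then 4 * barycentric f x else barycentric v x - barycentric f x)" for v
  define p where "p v = (if v = f then ref_barycenter else ref_vertex v)" for v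
  let ?C = "convex hull (insert ref_barycenter (ref_vertex ` ({..<4} - {f})))"
  have "(\<Sum>v<4. u v *\<^sub>R p v) \<in> ?C"
  proof (rule convex_sum)
    show "convex ?C" by simp
    show "(\<Sum>v<4. u v) = 1"
      unfolding sum_less_4 using f
      by (cases rule: less_4_cases) (simp_all add: u_def barycentric_simps)
    show "0 \<le> u v" if "v \<in> {..<4}" for v
      using that pos less[of v] by (auto simp: u_def)
    show "p v \<in> ?C" if "v \<in> {..<4}" for v
      using that by (auto simp: p_def intro!: hull_inc)
  qed simp
  moreover have "(\<Sum>v<4. u v *\<^sub>R p v) = x"
    unfolding sum_less_4 vec3_eq_iff using f
    by (cases rule: less_4_cases)
       (simp_all add: u_def p_def barycentric_simps ref_vertex_simps ref_barycenter_eq field_simps)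
  ultimately show ?thesis
    by (simp add: ref_subtet_def)
qed

lemma convex_ref_tet: "convex ref_tet"
  unfolding convex_alt by (auto simp: barycentric_segment ref_tet_iff intro!: add_nonneg_nonneg mult_nonneg_nonneg)

lemma ref_vertex_in_ref_tet: "f < 4 \<Longrightarrow> ref_vertex f \<in> ref_tet"
  by (erule less_4_cases) (simp_all add: ref_vertex_simps ref_tet_def)

lemma ref_subtet_subset: "ref_subtet f \<subseteq> ref_tet"
  unfolding ref_subtet_def
proof (rule hull_minimal)
  have "ref_barycenter \<in> ref_tet"
    by (simp add: ref_barycenter_eq ref_tet_def)
  then show "insert ref_barycenter (ref_vertex ` ({..<4} - {f})) \<subseteq> ref_tet"
    using ref_vertex_in_ref_tet by auto
qed (rule convex_ref_tet)

lemma compact_ref_subtet: "compact (ref_subtet f)"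
  unfolding ref_subtet_def by (intro finite_imp_compact_convex_hull) auto

lemma ref_subtet_interior_nonempty:
  assumes "f < 4"
  shows "interior (ref_subtet f) \<noteq> {}"
proof -
  let ?S = "\<Inter>g\<in>{..<4} - {f}. {x. 0 < barycentric f x \<and> barycentric f x < barycentric g x}"
  have "?S = {x. 0 < barycentric f x} \<inter> (\<Inter>g\<in>{..<4} - {f}. {x. barycentric f x < barycentric g x})"
    (is "_ = ?S'")
  proof -
    have "(if f = 0 then 1 else 0) \<in> {..<4} - {f}" by auto
    then show ?thesis by blast
  qed
  moreover have "open ?S'"
    using assms by (intro open_Int open_INT) (auto intro!: open_Collect_less continuous_barycentric)
  ultimately have "open ?S" by simp
  moreover have "?S \<subseteq> ref_subtet f"
  proof
    fix x assume x: "x \<in> ?S"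
    have "(if f = 0 then 1 else 0) \<in> {..<4} - {f}" by auto
    with x have "0 < barycentric f x" by blast
    then show "x \<in> ref_subtet f"
      using x by (intro ref_subtet_superset[OF assms]) auto
  qed
  ultimately have "?S \<subseteq> interior (ref_subtet f)"
    by (simp add: interior_maximal)
  \<comment> \<open>The point with coordinate 1/10 at vertex \<open>f\<close> and 3/10 at each of
    the other three.\<close>
  moreover have "vec_lambda (\<lambda>k. 3/10) - (if f = 0 then 0 else (2/10) *\<^sub>R barycentric_slope f) \<in> ?S"
  proof -
    let ?x = "vec_lambda (\<lambda>k. 3/10) - (if f = 0 then 0 else (2/10) *\<^sub>R barycentric_slope f)"
    have "\<forall>g<4. g \<noteq> f \<longrightarrow> 0 < barycentric f ?x \<and> barycentric f ?x < barycentric g ?x"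
      unfolding all_less_4 using assms
      by (cases rule: less_4_cases) (simp_all add: barycentric_simps barycentric_slope_def)
    then show ?thesis by auto
  qed
  ultimately show ?thesis by blast
qed

subsection \<open>Curved tetrahedra and their outward normals\<close>

lemma inner_gradient:
  assumes "f differentiable (at x)"
  shows "inner (gradient f x) v = frechet_derivative f (at x) v"
proof -
  let ?D = "frechet_derivative f (at x)"
  have lin: "linear ?D"
    using assms by (rule linear_frechet_derivative)
  have "v = (\<Sum>k\<in>UNIV. vec_nth v k *\<^sub>R axis k 1)"
    by (metis (no_types, lifting) basis_expansion scalar_mult_eq_scaleR sum.cong)
  then have "?D v = ?D (\<Sum>k\<in>UNIV. vec_nth v k *\<^sub>R axis k 1)"
    by simp
  also have "\<dots> = (\<Sum>k\<in>UNIV. vec_nth v k * ?D (axis k 1))"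
    by (simp add: linear_sum[OF lin] linear_cmul[OF lin])
  finally show ?thesis
    by (simp add: gradient_def inner_vec_def mult.commute)
qed

text \<open>The bisector \<open>sgn a + sgn b\<close> is the decisive test direction: its products
  with \<open>a\<close> and \<open>b\<close> are positive multiples of 1 + c, where c is the cosine
  of the angle, and its squared length is 2 (1 + c). Excluding it forces the length to be 0.\<close>

lemma sgn_opposite:
  fixes a b :: "'a::real_inner"
  assumes "a \<noteq> 0" "b \<noteq> 0" and "\<And>w. \<not> (0 < inner a w \<and> 0 < inner b w)"
  shows "sgn a = - sgn b"
proof -
  let ?c = "inner (sgn a) (sgn b)"
  have unit: "norm (sgn a) = 1" "norm (sgn b) = 1"
    using assms by (simp_all add: norm_sgn)
  have ab: "a = norm a *\<^sub>R sgn a" "b = norm b *\<^sub>R sgn b"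
    using assms by (simp_all add: sgn_div_norm)
  have sq: "inner (sgn a) (sgn a) = 1" "inner (sgn b) (sgn b) = 1"
    using unit by (simp_all add: dot_square_norm)
  have "inner a (sgn a + sgn b) = norm a * (1 + ?c)"
    by (subst ab(1)) (simp add: inner_add_right sq distrib_left)
  moreover have "inner b (sgn a + sgn b) = norm b * (1 + ?c)"
    by (subst ab(2)) (simp add: inner_add_right sq distrib_left inner_commute)
  ultimately have "\<not> 0 < 1 + ?c"
    using assms(1,2) assms(3)[of "sgn a + sgn b"] by (simp add: zero_less_mult_iff)
  moreover have "inner (sgn a + sgn b) (sgn a + sgn b) = 2 * (1 + ?c)"
    by (simp add: inner_add_right inner_add_left sq inner_commute)
  ultimately have "inner (sgn a + sgn b) (sgn a + sgn b) \<le> 0"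
    by simp
  then have "sgn a + sgn b = 0"
    using inner_ge_zero[of "sgn a + sgn b"] by (metis inner_eq_zero_iff order_antisym)
  then show ?thesis
    by (simp add: eq_neg_iff_add_eq_0)
qed

text \<open>Fixes the neighbourhood \<open>U\<close> that \<open>regular_tetrahedron\<close> only
  asserts to exist. Derivatives at boundary points of \<open>T\<close> make sense because
  \<open>U\<close> is open.\<close>

locale tet_chart =
  fixes T U :: "(real^3) set" and F :: "real^3 \<Rightarrow> real^3"
  assumes image: "F ` T = ref_tet"
    and open_domain: "open U"
    and subset_domain: "T \<subseteq> U"
    and inj: "inj_on F U"
    and differentiable: "x \<in> U \<Longrightarrow> F differentiable (at x)"
    and continuous_derivative: "continuous_on U (\<lambda>x. frechet_derivative F (at x) v)"
    and inj_derivative: "x \<in> U \<Longrightarrow> inj (frechet_derivative F (at x))"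
begin

lemma continuous_map: "continuous_on U F"
  using differentiable by (meson continuous_at_imp_continuous_on differentiable_imp_continuous_within)

lemma mem_iff: "x \<in> U \<Longrightarrow> x \<in> T \<longleftrightarrow> F x \<in> ref_tet"
  using image inj subset_domain by (metis image_eqI inj_on_image_mem_iff)

lemma open_vimage: "open W \<Longrightarrow> open {x \<in> U. F x \<in> W}"
  using continuous_open_preimage[OF continuous_map open_domain]
  by (simp add: Collect_conj_eq vimage_def)

lemma inverse_in: "y \<in> ref_tet \<Longrightarrow> inv_into T F y \<in> T"
  by (simp add: image inv_into_into)

lemma map_inverse: "y \<in> ref_tet \<Longrightarrow> F (inv_into T F y) = y"
  by (simp add: f_inv_into_f image)

lemma inverse_map: "x \<in> T \<Longrightarrow> inv_into T F (F x) = x"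
  using inj inj_on_subset inv_into_f_f subset_domain by metis

text \<open>By invariance of domain the injective continuous \<open>F\<close> is a homeomorphism of
  \<open>U\<close> onto its image, and its inverse agrees with \<open>inv_into T F\<close> on the
  reference tetrahedron.\<close>

lemma continuous_inverse: "continuous_on ref_tet (inv_into T F)"
proof -
  obtain g where g: "homeomorphism U (F ` U) F g"
    using invariance_of_domain_homeomorphism[OF open_domain continuous_map _ inj] by auto
  have "continuous_on ref_tet g"
    using homeomorphism_cont2[OF g] image subset_domain by (metis continuous_on_subset image_mono)
  moreover have "g y = inv_into T F y" if "y \<in> ref_tet" for y
    using homeomorphism_apply1[OF g] map_inverse[OF that] inverse_in[OF that] subset_domain
    by (metis subsetD)
  ultimately show ?thesis
    by (simp cong: continuous_on_cong)
qed

lemma compact_vimage: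
  assumes "compact K" "K \<subseteq> ref_tet"
  shows "compact {x \<in> T. F x \<in> K}"
proof -
  have "{x \<in> T. F x \<in> K} = inv_into T F ` K"
    using assms(2) inverse_in map_inverse inverse_map by (auto simp: image_iff subset_iff) metis
  then show ?thesis
    using assms continuous_inverse by (metis compact_continuous_image continuous_on_subset)
qed

definition face_set :: "nat \<Rightarrow> (real^3) set" where
  "face_set f = {x \<in> T. F x \<in> ref_face f}"

text \<open>On this open set membership in \<open>T\<close> depends on the sign of the single
  coordinate \<open>f\<close>. Its points on the face are the relatively interior ones.\<close>

definition face_nbhd :: "nat \<Rightarrow> (real^3) set" where
  "face_nbhd f = {x \<in> U. \<forall>g<4. g \<noteq> f \<longrightarrow> 0 < barycentric g (F x)}"

lemma open_face_nbhd: "open (face_nbhd f)"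
proof -
  have "open (\<Inter>g\<in>{..<4} - {f}. {y. 0 < barycentric g y})"
    by (intro open_INT) (auto intro!: open_Collect_less continuous_barycentric)
  moreover have "(\<Inter>g\<in>{..<4} - {f}. {y. 0 < barycentric g y}) = {y. \<forall>g<4. g \<noteq> f \<longrightarrow> 0 < barycentric g y}"
    by auto
  ultimately show ?thesis
    unfolding face_nbhd_def using open_vimage[of "{y. \<forall>g<4. g \<noteq> f \<longrightarrow> 0 < barycentric g y}"] by simp
qed

lemma closed_face_set:
  assumes "f < 4"
  shows "closed (face_set f)"
proof -
  have "compact ref_tet"
  proof -
    have "ref_tet \<subseteq> cbox (vector [0, 0, 0]) (vector [1, 1, 1])"
      by (auto simp: ref_tet_def mem_box_cart forall_3)
    then have "bounded ref_tet"
      using bounded_cbox bounded_subset by blast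
    moreover have "closed ref_tet"
    proof -
      have "ref_tet = (\<Inter>g\<in>{..<4}. {x. 0 \<le> barycentric g x})"
        by (auto simp: ref_tet_iff)
      moreover have "closed (\<Inter>g\<in>{..<4}. {x. 0 \<le> barycentric g x})"
        by (intro closed_INT) (auto intro!: closed_Collect_le continuous_barycentric)
      ultimately show ?thesis
        by simp
    qed
    ultimately show ?thesis
      by (simp add: compact_eq_bounded_closed)
  qed
  moreover have "closed {x. barycentric f x = 0}"
    using assms by (intro closed_Collect_eq continuous_barycentric) auto
  ultimately have "compact (ref_tet \<inter> {x. barycentric f x = 0})"
    by blast
  then have "compact (ref_face f)"
    by (simp add: ref_face_def Collect_conj_eq)
  then show ?thesis
    unfolding face_set_def
    by (intro compact_imp_closed compact_vimage) (auto simp: ref_face_def)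
qed

lemma face_set_dense:
  assumes "f < 4" "x \<in> face_set f" "0 < e"
  obtains y where "y \<in> face_set f" "y \<in> face_nbhd f" "dist x y < e"
proof -
  have x: "x \<in> T" "F x \<in> ref_face f" "F x \<in> ref_tet"
    using assms(2) by (auto simp: face_set_def ref_face_def)
  obtain \<delta> where \<delta>: "0 < \<delta>"
    "\<And>y. y \<in> ref_tet \<Longrightarrow> dist y (F x) < \<delta> \<Longrightarrow> dist (inv_into T F y) (inv_into T F (F x)) < e"
    using continuous_inverse x(3) \<open>0 < e\<close> unfolding continuous_on_iff by meson
  obtain y where y: "y \<in> ref_face f" "dist (F x) y < \<delta>" "\<And>g. g < 4 \<Longrightarrow> g \<noteq> f \<Longrightarrow> 0 < barycentric g y"
    using ref_face_dense_interior[OF assms(1) x(2) \<delta>(1)] by blast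
  have yt: "y \<in> ref_tet"
    using y(1) by (simp add: ref_face_def)
  show thesis
  proof (rule that[of "inv_into T F y"])
    show "inv_into T F y \<in> face_set f"
      using yt y(1) by (simp add: face_set_def inverse_in map_inverse)
    show "inv_into T F y \<in> face_nbhd f"
      using yt y(3) inverse_in subset_domain by (auto simp: face_nbhd_def map_inverse)
    show "dist x (inv_into T F y) < e"
      using \<delta>(2)[OF yt] y(2) x(1) by (simp add: inverse_map dist_commute)
  qed
qed

text \<open>A relatively interior point of one face lies on no other. This makes the definite
  description in \<open>local_face\<close> meaningful.\<close>

lemma face_set_inj:
  assumes "f < 4" "g < 4" "face_set f = face_set g"
  shows "f = g"
proof (rule ccontr)
  assume "f \<noteq> g"
  obtain m where m: "m \<in> ref_face f" "\<And>g. g < 4 \<Longrightarrow> g \<noteq> f \<Longrightarrow> 0 < barycentric g m"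
    using ref_face_centroid[OF assms(1)] by blast
  have "m \<in> ref_tet"
    using m(1) by (simp add: ref_face_def)
  then have "inv_into T F m \<in> face_set f" "inv_into T F m \<notin> face_set g"
    using m(1) m(2)[OF assms(2)] \<open>f \<noteq> g\<close>
    by (auto simp: face_set_def inverse_in map_inverse ref_face_def)
  then show False
    using assms(3) by simp
qed

text \<open>Up to length, the inward normal on face \<open>f\<close>.\<close>

definition barycentric_gradient :: "nat \<Rightarrow> real^3 \<Rightarrow> real^3" where
  "barycentric_gradient f = gradient (\<lambda>y. barycentric f (F y))"

lemma has_derivative_barycentric:
  assumes "x \<in> U" "f < 4"
  shows "((\<lambda>y. barycentric f (F y)) has_derivative
           (\<lambda>v. inner (barycentric_slope f) (frechet_derivative F (at x) v))) (at x)"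
proof -
  have "(F has_derivative frechet_derivative F (at x)) (at x)"
    using differentiable[OF assms(1)] by (simp add: frechet_derivative_works)
  then have "((\<lambda>y. barycentric f 0 + inner (barycentric_slope f) (F y)) has_derivative
      (\<lambda>v. 0 + inner (barycentric_slope f) (frechet_derivative F (at x) v))) (at x)"
    by (intro derivative_intros)
  then show ?thesis
    by (simp add: barycentric_eq[OF assms(2), symmetric])
qed

lemma inner_barycentric_gradient:
  assumes "x \<in> U" "f < 4"
  shows "inner (barycentric_gradient f x) v = inner (barycentric_slope f) (frechet_derivative F (at x) v)"
  unfolding barycentric_gradient_def
  using inner_gradient[of "\<lambda>y. barycentric f (F y)" x v] has_derivative_barycentric[OF assms]
  by (metis differentiableI frechet_derivative_at)

text \<open>An injective derivative on a three-dimensional space is onto, so some direction is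
  mapped to the slope itself, and along it the coordinate has positive derivative.\<close>

lemma barycentric_gradient_nonzero:
  assumes "x \<in> U" "f < 4"
  shows "barycentric_gradient f x \<noteq> 0"
proof
  assume zero: "barycentric_gradient f x = 0"
  have "linear (frechet_derivative F (at x))"
    using differentiable[OF assms(1)] by (rule linear_frechet_derivative)
  then have "surj (frechet_derivative F (at x))"
    using inj_derivative[OF assms(1)] linear_inj_imp_surj by blast
  then obtain v where "frechet_derivative F (at x) v = barycentric_slope f"
    by (metis surjD)
  then have "inner (barycentric_slope f) (barycentric_slope f) = 0"
    using inner_barycentric_gradient[OF assms, of v] zero by simp
  then show False
    using barycentric_slope_nonzero[OF assms(2)] by simp
qed

lemma continuous_barycentric_gradient:
  assumes "f < 4"
  shows "continuous_on U (barycentric_gradient f)"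
proof -
  have "continuous_on U (\<lambda>x. vec_nth (barycentric_gradient f x) k)" for k
  proof -
    have "vec_nth (barycentric_gradient f x) k
        = inner (barycentric_slope f) (frechet_derivative F (at x) (axis k 1))" if "x \<in> U" for x
      using inner_barycentric_gradient[OF that assms, of "axis k 1"] by (simp add: inner_axis)
    moreover have "continuous_on U
        (\<lambda>x. inner (barycentric_slope f) (frechet_derivative F (at x) (axis k 1)))"
      by (intro continuous_on_inner continuous_on_const continuous_derivative)
    ultimately show ?thesis
      by (metis (no_types, lifting) continuous_on_cong)
  qed
  then have "continuous_on U (\<lambda>x. vec_lambda (\<lambda>k. vec_nth (barycentric_gradient f x) k))"
    by (rule continuous_on_vec_lambda)
  then show ?thesis
    by simp
qed

text \<open>Along the ray, coordinate \<open>f\<close> starts at 0 with positive derivative, while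
  the other three stay positive because \<open>face_nbhd f\<close> is open.\<close>

lemma eventually_ray_in_interior:
  assumes f: "f < 4" and x: "x \<in> face_set f" "x \<in> face_nbhd f"
    and w: "0 < inner (barycentric_gradient f x) w"
  shows "eventually (\<lambda>h. x + h *\<^sub>R w \<in> interior T) (at_right 0)"
proof -
  have U: "x \<in> U" and zero: "barycentric f (F x) = 0"
    using x by (auto simp: face_nbhd_def face_set_def ref_face_def)
  let ?\<phi> = "\<lambda>h. barycentric f (F (x + h *\<^sub>R w))"
  have "((\<lambda>h. x + h *\<^sub>R w) has_derivative (\<lambda>h. 0 + h *\<^sub>R w)) (at 0)"
    by (intro derivative_intros)
  then have "(?\<phi> has_derivative
      (\<lambda>h. inner (barycentric_slope f) (frechet_derivative F (at x) (0 + h *\<^sub>R w)))) (at 0)"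
    using has_derivative_compose[of "\<lambda>h. x + h *\<^sub>R w" _ 0 UNIV "\<lambda>y. barycentric f (F y)"]
      has_derivative_barycentric[OF U f] by simp
  then have "(?\<phi> has_real_derivative inner (barycentric_gradient f x) w) (at 0)"
    unfolding has_field_derivative_def
    by (simp add: inner_barycentric_gradient[OF U f, symmetric] mult_commute_abs)
  then obtain \<delta> where \<delta>: "0 < \<delta>" "\<And>h. 0 < h \<Longrightarrow> h < \<delta> \<Longrightarrow> ?\<phi> 0 < ?\<phi> (0 + h)"
    using DERIV_pos_inc_right w by blast
  have "eventually (\<lambda>h. 0 < ?\<phi> h) (at_right 0)"
    by (rule eventually_at_rightI[of 0 \<delta>]) (use \<delta> zero in auto)
  moreover have "eventually (\<lambda>h. x + h *\<^sub>R w \<in> face_nbhd f) (at_right 0)"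
  proof -
    have "((\<lambda>h. x + h *\<^sub>R w) \<longlongrightarrow> x + 0 *\<^sub>R w) (at_right 0)"
      by (intro tendsto_intros)
    then show ?thesis
      using x(2) open_face_nbhd by (simp add: topological_tendstoD)
  qed
  ultimately show ?thesis
  proof eventually_elim
    case (elim h)
    \<comment> \<open>The points of \<open>U\<close> with four positive coordinates form an open set
      inside \<open>T\<close>.\<close>
    have sub: "{x \<in> U. F x \<in> {y. \<forall>g<4. 0 < barycentric g y}} \<subseteq> interior T"
    proof (rule interior_maximal)
      show "{x \<in> U. F x \<in> {y. \<forall>g<4. 0 < barycentric g y}} \<subseteq> T"
        using mem_iff by (auto simp: ref_tet_iff less_imp_le)
    qed (intro open_vimage open_ref_tet_interior)
    have "0 < barycentric g (F (x + h *\<^sub>R w))" if "g < 4" for g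
      using elim that by (cases "g = f") (auto simp: face_nbhd_def)
    then have "x + h *\<^sub>R w \<in> {x \<in> U. F x \<in> {y. \<forall>g<4. 0 < barycentric g y}}"
      using elim by (auto simp: face_nbhd_def)
    with sub show ?case
      by blast
  qed
qed

end

lemma opposite_normals:
  assumes "tet_chart T U F" "tet_chart T' U' F'" and f: "f < 4" "f' < 4"
    and same: "tet_chart.face_set T F f = tet_chart.face_set T' F' f'"
    and disjoint: "interior T \<inter> interior T' = {}"
    and x: "x \<in> tet_chart.face_set T F f"
  shows "sgn (tet_chart.barycentric_gradient F f x) = - sgn (tet_chart.barycentric_gradient F' f' x)"
proof -
  interpret L: tet_chart T U F by fact
  interpret R: tet_chart T' U' F' by fact
  let ?N = "\<lambda>x. sgn (L.barycentric_gradient f x) + sgn (R.barycentric_gradient f' x)"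
  \<comment> \<open>The points relatively interior to the face for both charts are dense in it, even though the two
    charts need not parametrize the face compatibly.\<close>
  let ?S = "L.face_set f \<inter> L.face_nbhd f \<inter> R.face_nbhd f'"
  have domain: "L.face_set f \<subseteq> U \<inter> U'"
    using same L.subset_domain R.subset_domain by (auto simp: L.face_set_def R.face_set_def)
  have "?N y = 0" if y: "y \<in> ?S" for y
  proof -
    \<comment> \<open>A ray ascending both barycentric coordinates would start in both disjoint interiors.\<close>
    have "\<not> (0 < inner (L.barycentric_gradient f y) w \<and> 0 < inner (R.barycentric_gradient f' y) w)" for w
    proof
      assume "0 < inner (L.barycentric_gradient f y) w \<and> 0 < inner (R.barycentric_gradient f' y) w"
      then have "eventually (\<lambda>h. y + h *\<^sub>R w \<in> interior T) (at_right 0)"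
        "eventually (\<lambda>h. y + h *\<^sub>R w \<in> interior T') (at_right 0)"
        using L.eventually_ray_in_interior[OF f(1)] R.eventually_ray_in_interior[OF f(2)] y same by auto
      then have "eventually (\<lambda>h. y + h *\<^sub>R w \<in> interior T \<inter> interior T') (at_right 0)"
        by eventually_elim auto
      then show False
        using disjoint by simp
    qed
    then have "sgn (L.barycentric_gradient f y) = - sgn (R.barycentric_gradient f' y)"
      using L.barycentric_gradient_nonzero[OF _ f(1)] R.barycentric_gradient_nonzero[OF _ f(2)]
        y domain by (intro sgn_opposite) auto
    then show ?thesis
      by simp
  qed
  moreover have "x \<in> closure ?S"
  proof (rule closure_approachable[THEN iffD2], intro allI impI)
    fix e :: real
    assume "0 < e"
    then obtain y where y: "y \<in> L.face_set f" "y \<in> L.face_nbhd f" "dist x y < e / 2"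
      using L.face_set_dense[OF f(1) x, of "e / 2"] by auto
    \<comment> \<open>Openness of \<open>L.face_nbhd f\<close> leaves room for a second small move,
      to a point that is relatively interior for the other chart too.\<close>
    obtain \<delta> where \<delta>: "0 < \<delta>" "ball y \<delta> \<subseteq> L.face_nbhd f"
      using L.open_face_nbhd y(2) open_contains_ball by blast
    have "0 < min \<delta> (e / 2)"
      using \<delta>(1) \<open>0 < e\<close> by simp
    then obtain z where z: "z \<in> R.face_set f'" "z \<in> R.face_nbhd f'" "dist y z < min \<delta> (e / 2)"
      using R.face_set_dense[OF f(2)] y(1) same by metis
    have "z \<in> ?S"
      using z same \<delta>(2) by auto
    moreover have "dist z x < e"
      using y(3) z(3) dist_triangle[of z x y] by (simp add: dist_commute)
    ultimately show "\<exists>y\<in>?S. dist y x < e"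
      by blast
  qed
  moreover have "continuous_on (closure ?S) ?N"
  proof -
    \<comment> \<open>Closedness of the face keeps the limit points in both domains, where the
      gradients are continuous and nonzero, so that \<open>sgn\<close> is continuous along
      them.\<close>
    have "closure ?S \<subseteq> L.face_set f"
      by (rule closure_minimal[OF _ L.closed_face_set[OF f(1)]]) auto
    then have "closure ?S \<subseteq> U" "closure ?S \<subseteq> U'"
      using domain by auto
    then show ?thesis
      using L.barycentric_gradient_nonzero[OF _ f(1)] R.barycentric_gradient_nonzero[OF _ f(2)]
      by (intro continuous_on_add continuous_on_sgn
          continuous_on_subset[OF L.continuous_barycentric_gradient[OF f(1)]]
          continuous_on_subset[OF R.continuous_barycentric_gradient[OF f(2)]]) auto
  qed
  ultimately have "?N x = 0"
    using continuous_constant_on_closure[of ?S ?N 0 x] by blast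
  then show ?thesis
    by (simp add: eq_neg_iff_add_eq_0)
qed

text \<open>The translation \<open>c\<close> will be \<open>offset d i j\<close>, which carries the
  element to its copy at the face. The derivative of the translated chart is the old one at the
  shifted point.\<close>

lemma regular_tetrahedron_chart:
  assumes "regular_tetrahedron T F"
  obtains U where "tet_chart ((\<lambda>x. x + c) ` T) U (\<lambda>x. F (x - c))"
proof -
  obtain U where U: "F ` T = ref_tet" "open U" "T \<subseteq> U" "inj_on F U"
    "\<And>x. x \<in> U \<Longrightarrow> F differentiable (at x)"
    "\<And>v. continuous_on U (\<lambda>x. frechet_derivative F (at x) v)"
    "\<And>x. x \<in> U \<Longrightarrow> inj (frechet_derivative F (at x))"
    using assms unfolding regular_tetrahedron_def by blast
  let ?F = "\<lambda>x. F (x - c)" and ?U = "(\<lambda>x. x + c) ` U"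
  have deriv: "(?F has_derivative frechet_derivative F (at (x - c))) (at x)" if "x \<in> ?U" for x
  proof -
    have "((\<lambda>x. x - c) has_derivative (\<lambda>v. v)) (at x)"
      by (auto intro!: derivative_eq_intros)
    moreover have "(F has_derivative frechet_derivative F (at (x - c))) (at (x - c))"
      using U(5) that by (auto simp: frechet_derivative_works[symmetric])
    ultimately show ?thesis
      using has_derivative_compose[of "\<lambda>x. x - c" "\<lambda>v. v" x UNIV F] by simp
  qed
  then have eq: "frechet_derivative ?F (at x) = frechet_derivative F (at (x - c))" if "x \<in> ?U" for x
    using frechet_derivative_at that by metis
  have "tet_chart ((\<lambda>x. x + c) ` T) ?U ?F"
  proof
    show "?F ` (\<lambda>x. x + c) ` T = ref_tet"
      using U(1) by (simp add: image_image)
    show "open ?U"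
      using open_translation[OF U(2), of c] by (simp add: add.commute)
    show "(\<lambda>x. x + c) ` T \<subseteq> ?U"
      using U(3) by auto
    show "inj_on ?F ?U"
      using U(4) by (auto simp: inj_on_def)
    show "?F differentiable (at x)" if "x \<in> ?U" for x
      using deriv[OF that] differentiableI by blast
    show "continuous_on ?U (\<lambda>x. frechet_derivative ?F (at x) v)" for v
    proof -
      have "continuous_on ?U (\<lambda>x. frechet_derivative F (at (x - c)) v)"
        by (rule continuous_on_compose2[OF U(6)]) (auto intro!: continuous_intros)
      then show ?thesis
        using eq by (simp cong: continuous_on_cong)
    qed
    show "inj (frechet_derivative ?F (at x))" if "x \<in> ?U" for x
      using eq[OF that] U(7) that by auto
  qed
  then show thesis
    by (rule that)
qed

lemma ref_face_param_in_ref_face: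
  assumes "f < 4" "u \<in> unit_triangle"
  shows "ref_face_param f u \<in> ref_face f"
proof -
  have "[0..<4] = [0, 1, 2, 3::nat]"
    by (simp add: upt_rec)
  then show ?thesis
    using assms
    by (elim less_4_cases)
       (auto simp: unit_triangle_def ref_face_param_def ref_face_def ref_tet_def barycentric_simps
         ref_vertex_simps)
qed

text \<open>Two integrands that agree on the surface give the same integral, with no question of
  integrability.\<close>

lemma surface_time_integral_cong:
  assumes "\<And>u t. u \<in> unit_triangle \<Longrightarrow> g (\<gamma> u) t = h (\<gamma> u) t"
  shows "surface_time_integral \<gamma> t0 t1 g = surface_time_integral \<gamma> t0 t1 h"
  unfolding surface_time_integral_def set_lebesgue_integral_def
  using assms by (intro Bochner_Integration.integral_cong) (auto split: split_indicator)

section \<open>Faces and normals of a valid mesh, and the relation between D and Q\<close>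

locale mesh =
  fixes d :: discretization
  assumes valid: "valid_mesh d"
begin

lemma sides:
  assumes "j < num_faces d"
  shows "left_elem d j < num_elems d" "right_elem d j < num_elems d" "left_elem d j \<noteq> right_elem d j"
    and "i < num_elems d \<Longrightarrow> j \<in> faces_of d i \<longleftrightarrow> i = left_elem d j \<or> i = right_elem d j"
    and "interior (elem_at d (left_elem d j) j) \<inter> interior (elem_at d (right_elem d j) j) = {}"
    and "0 < dual_length d j"
  using valid assms unfolding valid_mesh_def by blast+

lemma chart:
  assumes "i < num_elems d"
  obtains U where "tet_chart (elem_at d i j) U (ref_map_at d i j)"
proof -
  have "regular_tetrahedron (elem d i) (ref_map d i)"
    using valid assms unfolding valid_mesh_def by blast
  moreover have "ref_map_at d i j = (\<lambda>x. ref_map d i (x - offset d i j))"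
    by (simp add: fun_eq_iff ref_map_at_def)
  ultimately show thesis
    using that by (metis elem_at_def regular_tetrahedron_chart)
qed

lemma elem_face_at_eq:
  assumes "tet_chart (elem_at d i j) U (ref_map_at d i j)"
  shows "elem_face_at d i j f = tet_chart.face_set (elem_at d i j) (ref_map_at d i j) f"
  by (simp add: elem_face_at_def tet_chart.face_set_def[OF assms])

lemma local_face:
  assumes "i < num_elems d" "j \<in> faces_of d i"
  shows "local_face d i j < 4" "face d j = elem_face_at d i j (local_face d i j)"
proof -
  obtain U where U: "tet_chart (elem_at d i j) U (ref_map_at d i j)"
    using chart[OF assms(1)] .
  obtain f where f: "f < 4" "face d j = elem_face_at d i j f"
    using assms(2) by (auto simp: faces_of_def)
  have "local_face d i j = f"
    unfolding local_face_def
    using f tet_chart.face_set_inj[OF U] by (intro the_equality) (auto simp: elem_face_at_eq[OF U])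
  then show "local_face d i j < 4" "face d j = elem_face_at d i j (local_face d i j)"
    using f by auto
qed

lemma outward_normal_opposite:
  assumes j: "j < num_faces d" and x: "x \<in> face d j"
  shows "outward_normal d (right_elem d j) j x = - outward_normal d (left_elem d j) j x"
proof -
  let ?l = "left_elem d j" and ?r = "right_elem d j"
  note lt = sides(1,2)[OF j]
  obtain U where U: "tet_chart (elem_at d ?l j) U (ref_map_at d ?l j)"
    using chart[OF lt(1)] .
  obtain V where V: "tet_chart (elem_at d ?r j) V (ref_map_at d ?r j)"
    using chart[OF lt(2)] .
  have fl: "local_face d ?l j < 4" "face d j = elem_face_at d ?l j (local_face d ?l j)"
    using local_face[OF lt(1)] sides(4)[OF j lt(1)] by simp_all
  have fr: "local_face d ?r j < 4" "face d j = elem_face_at d ?r j (local_face d ?r j)"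
    using local_face[OF lt(2)] sides(4)[OF j lt(2)] by simp_all
  have "sgn (tet_chart.barycentric_gradient (ref_map_at d ?l j) (local_face d ?l j) x)
      = - sgn (tet_chart.barycentric_gradient (ref_map_at d ?r j) (local_face d ?r j) x)"
    using opposite_normals[OF U V fl(1) fr(1)] fl(2) fr(2) x sides(5)[OF j]
    by (simp add: elem_face_at_eq[OF U] elem_face_at_eq[OF V])
  then show ?thesis
    by (simp add: outward_normal_def tet_chart.barycentric_gradient_def[OF U]
        tet_chart.barycentric_gradient_def[OF V])
qed

lemma face_param_in_face:
  assumes j: "j < num_faces d" and u: "u \<in> unit_triangle"
  shows "face_param d j u \<in> face d j"
proof -
  let ?l = "left_elem d j"
  note lt = sides(1)[OF j]
  obtain U where "tet_chart (elem_at d ?l j) U (ref_map_at d ?l j)"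
    using chart[OF lt] .
  then interpret tet_chart "elem_at d ?l j" U "ref_map_at d ?l j" .
  have f: "local_face d ?l j < 4" "face d j = elem_face_at d ?l j (local_face d ?l j)"
    using local_face[OF lt] sides(4)[OF j lt] by simp_all
  have "ref_face_param (local_face d ?l j) u \<in> ref_face (local_face d ?l j)"
    by (rule ref_face_param_in_ref_face[OF f(1) u])
  then show ?thesis
    by (simp add: f(2) elem_face_at_def face_param_def Let_def ref_face_def inverse_in map_inverse)
qed

lemma side_sign_left: "j < num_faces d \<Longrightarrow> side_sign d (left_elem d j) j = 1"
  using sides(3)[of j] by (simp add: side_sign_def)

lemma side_sign_right: "j < num_faces d \<Longrightarrow> side_sign d (right_elem d j) j = -1"
  using sides(3)[of j] by (simp add: side_sign_def divide_eq_eq)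

text \<open>The volume terms correspond as they stand. The surface terms use the same
  parametrization, that of the left element, on both sides, so the normals can be compared inside
  the integrals, point by point on the face.\<close>

lemma D_mat_eq_Q_mat:
  assumes j: "j < num_faces d" and i: "i = left_elem d j \<or> i = right_elem d j"
    and "k < num_dofs d" "l < num_dofs d"
  shows "D_mat d i j $$ (k, l) = - Q_mat d i j $$ (l, k)"
proof -
  have "outward_normal d i j x = side_sign d i j *\<^sub>R face_normal d j x" if "x \<in> face d j" for x
    using i outward_normal_opposite[OF j that] side_sign_left[OF j] side_sign_right[OF j]
    by (auto simp: face_normal_def)
  then have "surface_time_integral (face_param d j) (t_old d) (t_new d)
       (\<lambda>x t. (phi_st_at d i j k x t * psi_st d j l x t) *\<^sub>R outward_normal d i j x)
     = surface_time_integral (face_param d j) (t_old d) (t_new d)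
       (\<lambda>x t. (psi_st d j l x t * phi_st_at d i j k x t * side_sign d i j) *\<^sub>R face_normal d j x)"
    using face_param_in_face[OF j] by (intro surface_time_integral_cong) (simp add: mult.commute)
  then show ?thesis
    using assms(3,4) by (simp add: D_mat_def Q_mat_def)
qed

end

subsection \<open>The mass matrices of the dual elements\<close>

lemma sum_diff_reindex: "(\<Sum>b<n. g (n - b)) = (\<Sum>b<n. g (Suc b) :: nat)"
proof -
  have "(\<Sum>b<n. g (n - b)) = (\<Sum>b<n. g (Suc (n - Suc b)))"
    by (rule sum.cong) (auto simp: Suc_diff_Suc)
  also have "\<dots> = (\<Sum>b<n. g (Suc b))"
    by (rule sum.nat_diff_reindex)
  finally show ?thesis .
qed

text \<open>For a fixed first exponent the remaining pairs are counted by a triangular number, and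
  these add up to a tetrahedral number. The factors 2 and 6 keep the inductions free of
  division.\<close>

lemma length_multi_indices: "length (multi_indices p) = num_basis p"
proof -
  have tri: "2 * (\<Sum>b<n. Suc b) = n * (n + 1)" for n
    by (induction n) auto
  have tetra: "6 * (\<Sum>a<n. \<Sum>b<Suc a. Suc b) = n * (n + 1) * (n + 2)" for n
  proof (induction n)
    case (Suc n)
    have "6 * (\<Sum>a<Suc n. \<Sum>b<Suc a. Suc b) = n * (n + 1) * (n + 2) + 3 * (2 * (\<Sum>b<Suc n. Suc b))"
      using Suc by simp
    also have "\<dots> = Suc n * (Suc n + 1) * (Suc n + 2)"
      unfolding tri by (simp add: algebra_simps)
    finally show ?case .
  qed simp
  have "length (multi_indices p) = (\<Sum>a<Suc p. \<Sum>b<Suc p - a. Suc p - a - b)"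
    by (simp add: multi_indices_def length_concat comp_def interv_sum_list_conv_sum_set_nat
        atLeast0LessThan)
  also have "\<dots> = (\<Sum>a<Suc p. \<Sum>b<Suc p - a. Suc b)"
    by (simp only: sum_diff_reindex[of "\<lambda>x. x"])
  also have "\<dots> = (\<Sum>a<Suc p. \<Sum>b<Suc a. Suc b)"
    by (rule sum_diff_reindex)
  finally have "6 * length (multi_indices p) = Suc p * (Suc p + 1) * (Suc p + 2)"
    by (simp only: tetra)
  then have "6 * length (multi_indices p) = (p + 1) * (p + 2) * (p + 3)"
    by (simp add: numeral_eq_Suc)
  then show ?thesis
    unfolding num_basis_def by (metis nonzero_mult_div_cancel_left zero_neq_numeral)
qed

lemma distinct_concat_map:
  assumes "distinct xs" "\<And>x. x \<in> set xs \<Longrightarrow> distinct (h x)"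
    and "\<And>x y. x \<in> set xs \<Longrightarrow> y \<in> set xs \<Longrightarrow> x \<noteq> y \<Longrightarrow> set (h x) \<inter> set (h y) = {}"
  shows "distinct (concat (map h xs))"
  using assms by (induction xs) auto

lemma distinct_multi_indices: "distinct (multi_indices p)"
  unfolding multi_indices_def
  by (intro distinct_concat_map) (auto simp: distinct_map inj_on_def)

lemma power_sum_eq_0:
  fixes g :: "nat \<Rightarrow> real"
  assumes "infinite X" "\<And>t. t \<in> X \<Longrightarrow> (\<Sum>i\<le>n. g i * t ^ i) = 0" "i \<le> n"
  shows "g i = 0"
proof (rule ccontr)
  assume "g i \<noteq> 0"
  then have "finite {t. (\<Sum>i\<le>n. g i * t ^ i) = 0}"
    using assms(3) polyfun_roots_finite[of g i n] by (simp add: ac_simps)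
  then show False
    using assms(1,2) by (metis (mono_tags, lifting) finite_subset mem_Collect_eq subsetI)
qed

text \<open>The open set contains a box. Variables are eliminated one at a time: with the others
  fixed, a polynomial in one variable vanishes at infinitely many points, so its coefficients
  vanish, and these are polynomials in the remaining variables.\<close>

lemma monomials_independent:
  assumes "finite I" "open S" "S \<noteq> {}"
    and zero: "\<And>x. x \<in> S \<Longrightarrow> (\<Sum>\<alpha>\<in>I. a \<alpha> * monomial \<alpha> x) = 0" and "\<alpha> \<in> I"
  shows "a \<alpha> = 0"
proof -
  obtain z e where z: "0 < e" "ball z e \<subseteq> S"
    using assms(2,3) open_contains_ball by blast
  \<comment> \<open>Three deviations below e/3 add up to less than e, which bounds the Euclidean
    distance.\<close>
  define X where "X k = {vec_nth z k - e / 3 <..< vec_nth z k + e / 3}" for k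
  have X: "infinite (X k)" for k
    using \<open>0 < e\<close> by (simp add: X_def infinite_Ioo)
  have in_S: "vector [x, y, w] \<in> S" if "x \<in> X 1" "y \<in> X 2" "w \<in> X 3" for x y w
  proof -
    have "norm (vector [x, y, w] - z) \<le> (\<Sum>k\<in>UNIV. \<bar>vec_nth (vector [x, y, w] - z) k\<bar>)"
      by (rule norm_le_l1_cart)
    also have "\<dots> < e"
      using that by (auto simp: sum_3 X_def abs_less_iff)
    finally show ?thesis
      using z(2) by (auto simp: dist_norm norm_minus_commute)
  qed
  obtain n where n: "I \<subseteq> {..n} \<times> {..n} \<times> {..n}"
  proof -
    let ?f = "\<lambda>(a, b, c). a + b + c :: nat"
    have "?f \<beta> \<le> Max (?f ` I)" if "\<beta> \<in> I" for \<beta>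
      using assms(1) that by simp
    then have "I \<subseteq> {..Max (?f ` I)} \<times> {..Max (?f ` I)} \<times> {..Max (?f ` I)}"
      by fastforce
    then show thesis
      by (rule that)
  qed
  \<comment> \<open>Extension by zero to a cube of exponents turns the sum over \<open>I\<close>
    into three nested sums.\<close>
  define a' where "a' \<beta> = (if \<beta> \<in> I then a \<beta> else 0)" for \<beta>
  have "(\<Sum>i\<le>n. (\<Sum>j\<le>n. (\<Sum>k\<le>n. a' (i, j, k) * w ^ k) * y ^ j) * x ^ i) = 0"
    if "x \<in> X 1" "y \<in> X 2" "w \<in> X 3" for x y w
  proof -
    have "(\<Sum>i\<le>n. (\<Sum>j\<le>n. (\<Sum>k\<le>n. a' (i, j, k) * w ^ k) * y ^ j) * x ^ i)
        = (\<Sum>\<beta>\<in>{..n} \<times> {..n} \<times> {..n}. a' \<beta> * monomial \<beta> (vector [x, y, w]))"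
      by (simp add: sum.cartesian_product' sum_distrib_left sum_distrib_right ac_simps)
    also have "\<dots> = (\<Sum>\<beta>\<in>I. a \<beta> * monomial \<beta> (vector [x, y, w]))"
      using n by (intro sum.mono_neutral_cong_right) (auto simp: a'_def)
    finally show ?thesis
      using zero in_S that by simp
  qed
  then have "(\<Sum>j\<le>n. (\<Sum>k\<le>n. a' (i, j, k) * w ^ k) * y ^ j) = 0"
    if "y \<in> X 2" "w \<in> X 3" "i \<le> n" for y w i
    using that power_sum_eq_0[OF X[of 1], where n = n and g = "\<lambda>i. \<Sum>j\<le>n. (\<Sum>k\<le>n. a' (i, j, k) * w ^ k) * y ^ j"]
    by blast
  then have "(\<Sum>k\<le>n. a' (i, j, k) * w ^ k) = 0"
    if "w \<in> X 3" "i \<le> n" "j \<le> n" for w i j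
    using that power_sum_eq_0[OF X[of 2], where n = n and g = "\<lambda>j. \<Sum>k\<le>n. a' (i, j, k) * w ^ k"] by blast
  then have "a' (i, j, k) = 0" if "i \<le> n" "j \<le> n" "k \<le> n" for i j k
    using that power_sum_eq_0[OF X[of 3], where n = n and g = "\<lambda>k. a' (i, j, k)"] by blast
  then have "a' \<alpha> = 0"
    using n \<open>\<alpha> \<in> I\<close> by (cases \<alpha>) auto
  then show ?thesis
    using \<open>\<alpha> \<in> I\<close> by (simp add: a'_def)
qed

text \<open>Translating \<open>S\<close> by the center and absorbing the nonzero powers of
  \<open>dual_length\<close> into the coefficients leaves plain monomials. Distinctness of the
  multi-indices lets coefficients be indexed by exponents instead of positions.\<close>

lemma psi_independent:
  assumes "0 < dual_length d j" "open S" "S \<noteq> {}"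
    and zero: "\<And>x. x \<in> S \<Longrightarrow> (\<Sum>k<num_basis (deg_space d). c k * psi d j k x) = 0"
    and k: "k < num_basis (deg_space d)"
  shows "c k = 0"
proof -
  let ?N = "num_basis (deg_space d)" and ?\<alpha> = "(!) (multi_indices (deg_space d))"
  have inj: "inj_on ?\<alpha> {..<?N}"
    using distinct_multi_indices by (auto simp: inj_on_def nth_eq_iff_index_eq length_multi_indices)
  define a where
    "a \<alpha> = c (the_inv_into {..<?N} ?\<alpha> \<alpha>) / dual_length d j ^ total_degree \<alpha>" for \<alpha>
  have a: "a (?\<alpha> k) = c k / dual_length d j ^ total_degree (?\<alpha> k)" if "k < ?N" for k
    using that by (simp add: a_def the_inv_into_f_f[OF inj])
  have "a (?\<alpha> k) = 0"
  proof (rule monomials_independent[of "?\<alpha> ` {..<?N}" "(\<lambda>x. - dual_center d j + x) ` S"])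
    show "open ((\<lambda>x. - dual_center d j + x) ` S)"
      using assms(2) by (rule open_translation)
    show "(\<Sum>\<alpha>\<in>?\<alpha> ` {..<?N}. a \<alpha> * monomial \<alpha> x) = 0" if x: "x \<in> (\<lambda>x. - dual_center d j + x) ` S" for x
    proof -
      obtain y where y: "y \<in> S" "x = - dual_center d j + y"
        using x by blast
      have "(\<Sum>\<alpha>\<in>?\<alpha> ` {..<?N}. a \<alpha> * monomial \<alpha> x) = (\<Sum>k<?N. c k * psi d j k y)"
        unfolding sum.reindex[OF inj] by (rule sum.cong) (simp_all add: a psi_def Let_def y(2))
      then show ?thesis
        using zero y(1) by simp
    qed
  qed (use assms k in auto)
  then show ?thesis
    using a[OF k] assms(1) by simp
qed

lemma
  fixes f :: "'i \<Rightarrow> 'a \<Rightarrow> 'b::{banach, second_countable_topology}"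
  assumes "finite I" "\<And>i. i \<in> I \<Longrightarrow> set_integrable M A (f i)"
  shows set_integral_sum: "(LINT x:A|M. \<Sum>i\<in>I. f i x) = (\<Sum>i\<in>I. LINT x:A|M. f i x)"
    and set_integrable_sum: "set_integrable M A (\<lambda>x. \<Sum>i\<in>I. f i x)"
  using assms unfolding set_lebesgue_integral_def set_integrable_def scaleR_sum_right
  by (intro Bochner_Integration.integral_sum Bochner_Integration.integrable_sum; blast)+

text \<open>The square vanishes almost everywhere on \<open>K\<close>, so the part of the interior
  where \<open>q\<close> is nonzero is an open null set and hence empty.\<close>

lemma set_integral_square_zero:
  fixes q :: "'a::euclidean_space \<Rightarrow> real"
  assumes "compact K" "continuous_on UNIV q" "(LINT z:K|lborel. (q z)\<^sup>2) = 0" "z \<in> interior K"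
  shows "q z = 0"
proof (rule ccontr)
  assume "q z \<noteq> 0"
  have cont: "continuous_on K (\<lambda>z. (q z)\<^sup>2)"
    using assms(2) by (intro continuous_on_power) (rule continuous_on_subset, auto)
  have "integrable lborel (\<lambda>z. indicator K z *\<^sub>R (q z)\<^sup>2)"
    using borel_integrable_compact[OF assms(1) cont] .
  then have "AE z in lborel. indicator K z *\<^sub>R (q z)\<^sup>2 = 0"
    using assms(3) unfolding set_lebesgue_integral_def
    by (subst (asm) integral_nonneg_eq_0_iff_AE) auto
  then obtain N where N: "N \<in> null_sets lborel" "{z. indicator K z *\<^sub>R (q z)\<^sup>2 \<noteq> 0} \<subseteq> N"
    unfolding eventually_ae_filter by auto
  let ?W = "interior K \<inter> {z. q z \<noteq> 0}"
  have "open ?W"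
    using assms(2) by (intro open_Int open_interior open_Collect_neq continuous_on_const)
  moreover have "?W \<subseteq> N"
    using N(2) interior_subset[of K] by (auto simp: indicator_def)
  moreover have "negligible N"
    using N(1) by (simp add: negligible_iff_null_sets null_sets_completionI)
  ultimately have "?W = {}"
    using negligible_subset open_not_negligible by blast
  then show False
    using assms(4) \<open>q z \<noteq> 0\<close> by blast
qed

lemma continuous_psi: "continuous_on S (psi d j k)"
proof -
  obtain a b c where "multi_indices (deg_space d) ! k = (a, b, c)"
    by (cases "multi_indices (deg_space d) ! k")
  then show ?thesis
    unfolding psi_def by (simp add: Let_def divide_inverse) (intro continuous_intros)
qed

context mesh
begin

text \<open>Compactness makes products of the continuous basis functions integrable over the dual
  element.\<close>

lemma dual_elem_compact:
  assumes j: "j < num_faces d"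
  shows "compact (dual_elem d j)"
proof -
  have "compact {x \<in> elem_at d i j. ref_map_at d i j x \<in> ref_subtet (local_face d i j)}"
    if i: "i < num_elems d" for i
  proof -
    obtain U where "tet_chart (elem_at d i j) U (ref_map_at d i j)"
      using chart[OF i] .
    then show ?thesis
      by (rule tet_chart.compact_vimage[OF _ compact_ref_subtet ref_subtet_subset])
  qed
  then show ?thesis
    unfolding dual_elem_def using sides(1,2)[OF j] by (intro compact_UN) auto
qed

lemma dual_elem_interior:
  assumes j: "j < num_faces d"
  shows "interior (dual_elem d j) \<noteq> {}"
proof -
  let ?l = "left_elem d j"
  note lt = sides(1)[OF j]
  obtain U where "tet_chart (elem_at d ?l j) U (ref_map_at d ?l j)"
    using chart[OF lt] .
  then interpret tet_chart "elem_at d ?l j" U "ref_map_at d ?l j" .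
  let ?f = "local_face d ?l j"
  have "?f < 4"
    using local_face[OF lt] sides(4)[OF j lt] by simp
  then obtain y where y: "y \<in> interior (ref_subtet ?f)"
    using ref_subtet_interior_nonempty by blast
  have sub: "interior (ref_subtet ?f) \<subseteq> ref_tet"
    using interior_subset ref_subtet_subset by blast
  \<comment> \<open>The half in the left element already contains an open set, namely the pulled
    back interior of its reference subtetrahedron.\<close>
  let ?W = "{x \<in> U. ref_map_at d ?l j x \<in> interior (ref_subtet ?f)}"
  have "?W \<subseteq> interior (dual_elem d j)"
  proof (rule interior_maximal)
    show "?W \<subseteq> dual_elem d j"
      using sub mem_iff interior_subset[of "ref_subtet ?f"] by (auto simp: dual_elem_def)
    show "open ?W"
      by (intro open_vimage open_interior)
  qed
  moreover have "inv_into (elem_at d ?l j) (ref_map_at d ?l j) y \<in> ?W"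
    using y sub inverse_in[of y] map_inverse[of y] subset_domain by auto
  ultimately show ?thesis
    by blast
qed

end

section \<open>Invertibility of the dual mass matrices for constants in time\<close>

locale mesh_constant_in_time = mesh +
  assumes time: "t_old d < t_new d" and deg_time: "deg_time d = 0"
begin

lemma num_dofs_eq: "num_dofs d = num_basis (deg_space d)"
  by (simp add: num_dofs_def deg_time)

text \<open>The time index \<open>k div num_basis (deg_space d)\<close> is 0, so the Lagrange
  product runs over the empty set \<open>{..0} - {0}\<close>.\<close>

lemma time_factor_eq_1: "k < num_dofs d \<Longrightarrow> time_factor d k t = 1"
  by (simp add: time_factor_def time_basis_def num_dofs_eq deg_time)

lemma psi_st_eq: "k < num_dofs d \<Longrightarrow> psi_st d j k x t = psi d j k x"
  by (simp add: psi_st_def time_factor_eq_1 num_dofs_eq[symmetric])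

lemma phi_st_eq: "k < num_dofs d \<Longrightarrow> phi_st d i k x t = phi d i k x"
  by (simp add: phi_st_def time_factor_eq_1 num_dofs_eq[symmetric])

lemma M_dual_symmetric: "transpose_mat (M_dual d j) = M_dual d j"
  by (rule eq_matI) (simp_all add: M_dual_def mult.commute)

lemma M_dual_carrier: "M_dual d j \<in> carrier_mat (num_dofs d) (num_dofs d)"
  by (simp add: M_dual_def)

lemma M_dual_quadratic_form:
  assumes j: "j < num_faces d"
  shows "(\<Sum>k<num_dofs d. \<Sum>l<num_dofs d. c k * (M_dual d j $$ (k, l) * c l))
    = (LINT z:dual_elem d j \<times> {t_old d..t_new d}|lborel. (\<Sum>k<num_dofs d. c k * psi d j k (fst z))\<^sup>2)"
proof -
  let ?K = "dual_elem d j \<times> {t_old d..t_new d}"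
  have K: "compact ?K"
    using dual_elem_compact[OF j] by (intro compact_Times) auto
  have integrable: "set_integrable lborel ?K (\<lambda>z. c k * (psi d j k (fst z) * psi d j l (fst z) * c l))" for k l
    unfolding set_integrable_def
    by (intro borel_integrable_compact K continuous_intros continuous_on_compose2[OF continuous_psi]) auto
  have "(LINT z:?K|lborel. (\<Sum>k<num_dofs d. c k * psi d j k (fst z))\<^sup>2)
      = (LINT z:?K|lborel. \<Sum>k<num_dofs d. \<Sum>l<num_dofs d. c k * (psi d j k (fst z) * psi d j l (fst z) * c l))"
    by (simp add: power2_eq_square sum_product ac_simps)
  also have "\<dots> = (\<Sum>k<num_dofs d. \<Sum>l<num_dofs d.
      LINT z:?K|lborel. c k * (psi d j k (fst z) * psi d j l (fst z) * c l))"
    by (simp only: set_integral_sum set_integrable_sum integrable finite_lessThan)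
  also have "\<dots> = (\<Sum>k<num_dofs d. \<Sum>l<num_dofs d. c k * (M_dual d j $$ (k, l) * c l))"
    by (intro sum.cong) (simp_all add: M_dual_def volume_time_integral_def psi_st_eq)
  finally show ?thesis
    by simp
qed

lemma M_dual_kernel:
  assumes j: "j < num_faces d" and v: "v \<in> carrier_vec (num_dofs d)" "M_dual d j *\<^sub>v v = 0\<^sub>v (num_dofs d)"
  shows "v = 0\<^sub>v (num_dofs d)"
proof -
  let ?n = "num_dofs d" and ?K = "dual_elem d j \<times> {t_old d..t_new d}"
  let ?q = "\<lambda>z. \<Sum>k<?n. v $ k * psi d j k (fst z)"
  have row: "(\<Sum>l<?n. M_dual d j $$ (k, l) * v $ l) = 0" if "k < ?n" for k
  proof -
    have "(\<Sum>l<?n. M_dual d j $$ (k, l) * v $ l) = (M_dual d j *\<^sub>v v) $ k"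
      using that v(1) M_dual_carrier[of j] by (simp add: scalar_prod_def atLeast0LessThan)
    then show ?thesis
      using that v(2) by simp
  qed
  have "(\<Sum>k<?n. \<Sum>l<?n. v $ k * (M_dual d j $$ (k, l) * v $ l)) = 0"
    using row by (simp add: sum_distrib_left[symmetric])
  then have zero: "(LINT z:?K|lborel. (?q z)\<^sup>2) = 0"
    using M_dual_quadratic_form[OF j, of "\<lambda>k. v $ k"] by simp
  have "(\<Sum>k<num_basis (deg_space d). v $ k * psi d j k x) = 0" if "x \<in> interior (dual_elem d j)" for x
  proof -
    \<comment> \<open>The integrand is constant in time, so any interior time would serve. The
      midpoint is interior because the time step is positive.\<close>
    have "(x, (t_old d + t_new d) / 2) \<in> interior ?K"
      using that time by (simp add: interior_Times)
    moreover have "compact ?K"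
      using dual_elem_compact[OF j] by (intro compact_Times) auto
    moreover have "continuous_on UNIV ?q"
      by (intro continuous_intros continuous_on_compose2[OF continuous_psi]) auto
    ultimately have "?q (x, (t_old d + t_new d) / 2) = 0"
      using zero by (intro set_integral_square_zero[of ?K ?q])
    then show ?thesis
      by (simp add: num_dofs_eq)
  qed
  then have "v $ k = 0" if "k < ?n" for k
    using psi_independent[of d j "interior (dual_elem d j)" "\<lambda>k. v $ k"] that
      sides(6)[OF j] dual_elem_interior[OF j] by (simp add: num_dofs_eq)
  then show ?thesis
    using v(1) by (intro eq_vecI) auto
qed

definition M_dual_inverse :: "nat \<Rightarrow> real mat" where
  "M_dual_inverse j = the (mat_inverse (M_dual d j))"

text \<open>A trivial kernel gives a nonzero determinant, so the matrix is a unit and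
  \<open>mat_inverse\<close> cannot return \<open>None\<close>. The transpose of the inverse is a
  left inverse of the symmetric matrix, and a left inverse coincides with a right one.\<close>

lemma M_dual_inverse_symmetric:
  assumes j: "j < num_faces d"
  shows "M_dual_inverse j \<in> carrier_mat (num_dofs d) (num_dofs d)"
    and "transpose_mat (M_dual_inverse j) = M_dual_inverse j"
proof -
  let ?n = "num_dofs d" and ?M = "M_dual d j" and ?W = "M_dual_inverse j"
  note M = M_dual_carrier[of j]
  have "Determinant.det ?M \<noteq> 0"
    using det_0_iff_vec_prod_zero_field[OF M] M_dual_kernel[OF j] by blast
  then have "?M \<in> Units (ring_mat TYPE(real) ?n ())"
    using det_non_zero_imp_unit[OF M, of "()"] by blast
  then obtain W where W: "mat_inverse ?M = Some W"
    using mat_inverse(1)[OF M, of "()"] by (cases "mat_inverse ?M") auto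
  then have "?W = W"
    by (simp add: M_dual_inverse_def)
  then have inv: "?M * ?W = 1\<^sub>m ?n" "?W * ?M = 1\<^sub>m ?n" and carrier: "?W \<in> carrier_mat ?n ?n"
    using mat_inverse(2)[OF M W] by auto
  show "?W \<in> carrier_mat ?n ?n"
    by (rule carrier)
  have "transpose_mat ?W * ?M = transpose_mat (?M * ?W)"
    using transpose_mult[OF M carrier] by (simp add: M_dual_symmetric)
  then have left: "transpose_mat ?W * ?M = 1\<^sub>m ?n"
    by (simp add: inv)
  have "transpose_mat ?W = transpose_mat ?W * (?M * ?W)"
    using carrier by (simp add: inv)
  also have "\<dots> = (transpose_mat ?W * ?M) * ?W"
    using carrier M by (intro assoc_mult_mat[symmetric, of _ ?n ?n _ ?n _ ?n]) auto
  also have "\<dots> = ?W"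
    using carrier by (simp add: left)
  finally show "transpose_mat ?W = ?W" .
qed

end

subsection \<open>Assembling the system\<close>

lemma sum_lessThan_mult:
  fixes g :: "nat \<Rightarrow> 'a::comm_monoid_add"
  shows "(\<Sum>J<N * n. g J) = (\<Sum>i<N. \<Sum>l<n. g (i * n + l))"
proof -
  have "(\<Sum>J<N * n. g J) = (\<Sum>i<N. sum g {i * n..<i * n + n})"
    by (rule sum.nat_group[symmetric])
  also have "\<dots> = (\<Sum>i<N. \<Sum>l<n. g (i * n + l))"
    by (simp add: sum.atLeastLessThan_shift_0[of g "_ * n"] atLeast0LessThan comp_def)
  finally show ?thesis .
qed

lemma block_index_less: "i < N \<Longrightarrow> k < n \<Longrightarrow> i * n + k < N * (n::nat)"
proof -
  assume "i < N" "k < n"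
  then have "i * n + k < Suc i * n" by simp
  also have "\<dots> \<le> N * n"
    using \<open>i < N\<close> by (intro mult_le_mono1) simp
  finally show ?thesis .
qed

lemma stack_index:
  assumes "i < num_elems d" "k < num_dofs d"
  shows "stack d v $ (i * num_dofs d + k) = v i $ k"
  using assms by (simp add: stack_def block_index_less)

lemma stack_eq_iff:
  assumes "block_family d v" "block_family d w"
  shows "stack d v = stack d w \<longleftrightarrow> (\<forall>i<num_elems d. v i = w i)"
proof
  assume eq: "stack d v = stack d w"
  show "\<forall>i<num_elems d. v i = w i"
  proof (intro allI impI)
    fix i
    assume i: "i < num_elems d"
    show "v i = w i"
    proof (rule eq_vecI)
      show "v i $ k = w i $ k" if "k < dim_vec (w i)" for k
        using that i assms(2) stack_index[of i d k v] stack_index[of i d k w] eq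
        by (auto simp: block_family_def)
    qed (use assms i in \<open>auto simp: block_family_def\<close>)
  qed
next
  assume "\<forall>i<num_elems d. v i = w i"
  then show "stack d v = stack d w"
    unfolding stack_def by (intro eq_vecI) (auto simp: less_mult_imp_div_less)
qed

lemma stack_surjective:
  assumes "x \<in> carrier_vec (num_elems d * num_dofs d)"
  obtains v where "block_family d v" "stack d v = x"
proof
  let ?v = "\<lambda>i. vec (num_dofs d) (\<lambda>k. x $ (i * num_dofs d + k))"
  show "block_family d ?v"
    by (simp add: block_family_def)
  show "stack d ?v = x"
  proof (rule eq_vecI)
    fix I
    assume "I < dim_vec x"
    then have I: "I < num_elems d * num_dofs d"
      using assms by simp
    \<comment> \<open>An index below the product forces nonempty blocks, so that the remainder
      modulo the block size is a valid position in a block.\<close>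
    then have "0 < num_dofs d"
      by (cases "num_dofs d") auto
    then show "stack d ?v $ I = x $ I"
      using I by (simp add: stack_def)
  qed (use assms in \<open>simp add: stack_def\<close>)
qed

text \<open>For any \<open>x\<close>, both \<open>x\<close> and \<open>A *\<^sub>v x\<close> are
  stacked families. The system with these as unknown and right-hand side holds by the property of
  \<open>A\<close>, so the property of \<open>B\<close> gives
  \<open>B *\<^sub>v x = A *\<^sub>v x\<close>.\<close>

lemma coefficient_matrix_unique:
  assumes "coefficient_matrix d \<nu> A" "coefficient_matrix d \<nu> B"
  shows "A = B"
proof -
  let ?m = "num_elems d * num_dofs d"
  have carrier: "A \<in> carrier_mat ?m ?m" "B \<in> carrier_mat ?m ?m"
    using assms by (auto simp: coefficient_matrix_def)
  have eq: "A *\<^sub>v x = B *\<^sub>v x" if x: "x \<in> carrier_vec ?m" for x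
  proof -
    obtain v where v: "block_family d v" "stack d v = x"
      using stack_surjective[OF x] .
    have "A *\<^sub>v x \<in> carrier_vec ?m"
      using carrier(1) x by simp
    then obtain b where b: "block_family d b" "stack d b = A *\<^sub>v x"
      using stack_surjective by blast
    have "A *\<^sub>v stack d v = stack d b"
      by (simp add: v b)
    then have "B *\<^sub>v stack d v = stack d b"
      using assms v(1) b(1) unfolding coefficient_matrix_def by blast
    then show ?thesis
      by (simp add: v b)
  qed
  show ?thesis
  proof (rule eq_matI)
    fix I J
    assume IJ: "I < dim_row B" "J < dim_col B"
    then have "A $$ (I, J) = (A *\<^sub>v unit_vec ?m J) $ I" "B $$ (I, J) = (B *\<^sub>v unit_vec ?m J) $ I"
      using carrier by (auto simp: scalar_prod_right_unit)
    then show "A $$ (I, J) = B $$ (I, J)"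
      using eq by simp
  qed (use carrier in auto)
qed

definition block_mat :: "nat \<Rightarrow> nat \<Rightarrow> (nat \<Rightarrow> nat \<Rightarrow> 'a mat) \<Rightarrow> 'a mat" where
  "block_mat N n B = mat (N * n) (N * n) (\<lambda>(I, J). B (I div n) (J div n) $$ (I mod n, J mod n))"

lemma block_mat_mult_stack:
  "block_mat (num_elems d) (num_dofs d) B *\<^sub>v stack d v =
    stack d (\<lambda>i. vec (num_dofs d) (\<lambda>k. \<Sum>i'<num_elems d. \<Sum>l<num_dofs d. B i i' $$ (k, l) * v i' $ l))"
proof (rule eq_vecI)
  let ?n = "num_dofs d" and ?N = "num_elems d"
  fix I
  assume "I < dim_vec (stack d (\<lambda>i. vec ?n (\<lambda>k. \<Sum>i'<?N. \<Sum>l<?n. B i i' $$ (k, l) * v i' $ l)))"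
  then have I: "I < ?N * ?n"
    by (simp add: stack_def)
  then have n: "0 < ?n"
    by (cases ?n) auto
  have "(block_mat ?N ?n B *\<^sub>v stack d v) $ I
      = (\<Sum>J<?N * ?n. B (I div ?n) (J div ?n) $$ (I mod ?n, J mod ?n) * stack d v $ J)"
    using I by (simp add: block_mat_def scalar_prod_def stack_def atLeast0LessThan)
  also have "\<dots> = (\<Sum>i'<?N. \<Sum>l<?n. B (I div ?n) i' $$ (I mod ?n, l) * v i' $ l)"
    unfolding sum_lessThan_mult by (intro sum.cong) (simp_all add: stack_index)
  finally show "(block_mat ?N ?n B *\<^sub>v stack d v) $ I
      = stack d (\<lambda>i. vec ?n (\<lambda>k. \<Sum>i'<?N. \<Sum>l<?n. B i i' $$ (k, l) * v i' $ l)) $ I"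
    using I n by (simp add: stack_def)
qed (simp add: block_mat_def stack_def)

lemma transpose_block_mat:
  assumes "\<And>i i' k l. \<lbrakk>i < N; i' < N; k < n; l < n\<rbrakk> \<Longrightarrow> B i i' $$ (k, l) = B i' i $$ (l, k)"
  shows "transpose_mat (block_mat N n B) = block_mat N n B"
proof (rule eq_matI)
  fix I J
  assume "I < dim_row (block_mat N n B)" "J < dim_col (block_mat N n B)"
  then have IJ: "I < N * n" "J < N * n"
    by (simp_all add: block_mat_def)
  then have "0 < n"
    by (cases n) auto
  then show "transpose_mat (block_mat N n B) $$ (I, J) = block_mat N n B $$ (I, J)"
    using IJ assms[of "J div n" "I div n" "J mod n" "I mod n"]
    by (simp add: block_mat_def less_mult_imp_div_less)
qed (simp_all add: block_mat_def)

text \<open>Two elements may share several faces when sides of the domain are identified, hence the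
  sum over all faces leading to \<open>i'\<close>. In a valid mesh no element neighbours itself, so
  this sum is empty for \<open>i = i'\<close>.\<close>

definition system_block :: "discretization \<Rightarrow> real \<Rightarrow> nat \<Rightarrow> nat \<Rightarrow> real mat" where
  "system_block d \<nu> i i' = mat (num_dofs d) (num_dofs d) (\<lambda>(k, l).
     (if i = i' then diagonal_block d \<nu> i $$ (k, l) else 0)
     - \<nu> * (\<Sum>j\<in>{j \<in> faces_of d i. neighbour d i j = i'}. DMQ d i j i' $$ (k, l)))"

lemma finite_faces_of: "finite (faces_of d i)"
  by (simp add: faces_of_def)

context mesh
begin

lemma neighbour_less:
  assumes "j \<in> faces_of d i"
  shows "neighbour d i j < num_elems d"
  using assms sides(1,2)[of j] by (auto simp: faces_of_def neighbour_def)

lemma faces_with_neighbour: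
  assumes "i < num_elems d" "i' < num_elems d"
  shows "{j \<in> faces_of d i. neighbour d i j = i'} = {j \<in> faces_of d i'. neighbour d i' j = i}"
proof -
  \<comment> \<open>Quantified over both elements, this one implication serves for both
    inclusions.\<close>
  have "j \<in> faces_of d i'" "neighbour d i' j = i"
    if lt: "i < num_elems d" "i' < num_elems d" and j: "j \<in> faces_of d i" "neighbour d i j = i'" for i i' j
  proof -
    have j': "j < num_faces d"
      using j(1) by (simp add: faces_of_def)
    show "j \<in> faces_of d i'" "neighbour d i' j = i"
      using sides(3)[OF j'] sides(4)[OF j' lt(1)] sides(4)[OF j' lt(2)] j
      by (auto simp: neighbour_def split: if_splits)
  qed
  then show ?thesis
    using assms by blast
qed

lemma viscous_lhs_eq:
  assumes i: "i < num_elems d" and v: "block_family d v"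
  shows "viscous_lhs d \<nu> v i =
    vec (num_dofs d) (\<lambda>k. \<Sum>i'<num_elems d. \<Sum>l<num_dofs d. system_block d \<nu> i i' $$ (k, l) * v i' $ l)"
proof (rule eq_vecI)
  let ?n = "num_dofs d" and ?N = "num_elems d"
  fix k
  assume "k < dim_vec (vec ?n (\<lambda>k. \<Sum>i'<?N. \<Sum>l<?n. system_block d \<nu> i i' $$ (k, l) * v i' $ l))"
  then have k: "k < ?n" by simp
  have dim: "dim_vec (v i') = ?n" if "i' < ?N" for i'
    using v that by (simp add: block_family_def)
  let ?D = "\<lambda>j i'. \<Sum>l<?n. DMQ d i j i' $$ (k, l) * v i' $ l"
  have "(\<Sum>l<?n. system_block d \<nu> i i' $$ (k, l) * v i' $ l)
      = (if i = i' then \<Sum>l<?n. diagonal_block d \<nu> i $$ (k, l) * v i $ l else 0)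
        - \<nu> * (\<Sum>j\<in>{j \<in> faces_of d i. neighbour d i j = i'}. ?D j i')" for i'
  proof -
    have "(\<Sum>j\<in>S. ?D j i') = (\<Sum>l<?n. (\<Sum>j\<in>S. DMQ d i j i' $$ (k, l)) * v i' $ l)" for S
      by (subst sum.swap) (simp add: sum_distrib_right)
    then show ?thesis
      using k by (simp add: system_block_def left_diff_distrib sum_subtractf mult.assoc flip: sum_distrib_left)
  qed
  then have "(\<Sum>i'<?N. \<Sum>l<?n. system_block d \<nu> i i' $$ (k, l) * v i' $ l)
      = (\<Sum>l<?n. diagonal_block d \<nu> i $$ (k, l) * v i $ l)
        - \<nu> * (\<Sum>i'<?N. \<Sum>j\<in>{j \<in> faces_of d i. neighbour d i j = i'}. ?D j i')"
    using i by (simp add: sum_subtractf sum_distrib_left)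
  \<comment> \<open>Within each group \<open>i'\<close> is the neighbour across \<open>j\<close>.
    Once the summand depends on \<open>j\<close> alone, the groups merge into one sum over the faces
    of \<open>i\<close>.\<close>
  also have "(\<Sum>i'<?N. \<Sum>j\<in>{j \<in> faces_of d i. neighbour d i j = i'}. ?D j i')
      = (\<Sum>i'<?N. \<Sum>j\<in>{j \<in> faces_of d i. neighbour d i j = i'}. ?D j (neighbour d i j))"
    by simp
  also have "\<dots> = (\<Sum>j\<in>faces_of d i. ?D j (neighbour d i j))"
    using neighbour_less finite_faces_of by (intro sum.group) auto
  also have "\<dots> = (\<Sum>j\<in>faces_of d i. (DMQ d i j (neighbour d i j) *\<^sub>v v (neighbour d i j)) $ k)"
    using k neighbour_less dim
    by (intro sum.cong) (auto simp: DMQ_def scalar_prod_def atLeast0LessThan)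
  also have "(\<Sum>l<?n. diagonal_block d \<nu> i $$ (k, l) * v i $ l) = (diagonal_block d \<nu> i *\<^sub>v v i) $ k"
    using k i dim by (auto simp: diagonal_block_def scalar_prod_def atLeast0LessThan)
  finally show "viscous_lhs d \<nu> v i $ k
      = vec ?n (\<lambda>k. \<Sum>i'<?N. \<Sum>l<?n. system_block d \<nu> i i' $$ (k, l) * v i' $ l) $ k"
    using k by (simp add: viscous_lhs_def)
qed (simp add: viscous_lhs_def)

lemma coefficient_matrix_block_mat:
  "coefficient_matrix d \<nu> (block_mat (num_elems d) (num_dofs d) (system_block d \<nu>))"
  unfolding coefficient_matrix_def
proof (intro conjI allI impI)
  fix v b
  assume vb: "block_family d v" "block_family d b"
  let ?w = "\<lambda>i. vec (num_dofs d)
    (\<lambda>k. \<Sum>i'<num_elems d. \<Sum>l<num_dofs d. system_block d \<nu> i i' $$ (k, l) * v i' $ l)"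
  have "block_family d ?w"
    by (simp add: block_family_def)
  then show "viscous_system d \<nu> v b \<longleftrightarrow>
      block_mat (num_elems d) (num_dofs d) (system_block d \<nu>) *\<^sub>v stack d v = stack d b"
    using vb by (simp add: block_mat_mult_stack stack_eq_iff viscous_system_def viscous_lhs_eq)
qed (simp add: block_mat_def)

end

section \<open>Symmetry of the blocks and of the assembled matrix\<close>

context mesh_constant_in_time
begin

lemma M_elem_symmetric:
  assumes "k < num_dofs d" "l < num_dofs d"
  shows "M_elem d i $$ (k, l) = M_elem d i $$ (l, k)"
proof -
  \<comment> \<open>Stated as an equality of functions of time, so that it also rewrites under
    \<open>deriv\<close>.\<close>
  have "phi_st d i k x = (\<lambda>t. phi d i k x)" if "k < num_dofs d" for k x
    using phi_st_eq[OF that] by blast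
  then show ?thesis
    using assms by (simp add: M_elem_def volume_time_integral_def mult.commute)
qed

text \<open>\<open>D_mat_eq_Q_mat\<close> is used once for each factor, so the two signs cancel. The
  exchanged indices \<open>a\<close> and \<open>b\<close> are absorbed by the symmetry of the
  inverse. The case \<open>i = i'\<close> gives the diagonal contributions.\<close>

lemma DMQ_symmetric:
  assumes j: "j < num_faces d"
    and i: "i = left_elem d j \<or> i = right_elem d j" "i' = left_elem d j \<or> i' = right_elem d j"
    and kl: "k < num_dofs d" "l < num_dofs d"
  shows "DMQ d i j i' $$ (k, l) = DMQ d i' j i $$ (l, k)"
proof -
  let ?n = "num_dofs d" and ?W = "M_dual_inverse j"
  have W: "?W $$ (a, b) = ?W $$ (b, a)" if "a < ?n" "b < ?n" for a b
    using that M_dual_inverse_symmetric[OF j] by (metis carrier_matD index_transpose_mat(1))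
  have "DMQ d i j i' $$ (k, l) = (\<Sum>a<?n. \<Sum>b<?n. ?W $$ (a, b) * inner (D_mat d i j $$ (k, a)) (Q_mat d i' j $$ (b, l)))"
    using kl by (simp add: DMQ_def M_dual_inverse_def)
  also have "\<dots> = (\<Sum>a<?n. \<Sum>b<?n. ?W $$ (b, a) * inner (D_mat d i' j $$ (l, b)) (Q_mat d i j $$ (a, k)))"
    using kl by (intro sum.cong refl) (simp add: W D_mat_eq_Q_mat[OF j i(1)] D_mat_eq_Q_mat[OF j i(2)] inner_commute)
  also have "\<dots> = (\<Sum>b<?n. \<Sum>a<?n. ?W $$ (b, a) * inner (D_mat d i' j $$ (l, b)) (Q_mat d i j $$ (a, k)))"
    by (rule sum.swap)
  also have "\<dots> = DMQ d i' j i $$ (l, k)"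
    using kl by (simp add: DMQ_def M_dual_inverse_def)
  finally show ?thesis .
qed

lemma system_block_symmetric:
  assumes i: "i < num_elems d" "i' < num_elems d" and kl: "k < num_dofs d" "l < num_dofs d"
  shows "system_block d \<nu> i i' $$ (k, l) = system_block d \<nu> i' i $$ (l, k)"
proof -
  have DMQ: "DMQ d i j i' $$ (k, l) = DMQ d i' j i $$ (l, k)"
    if "i < num_elems d" "i' < num_elems d" "j \<in> faces_of d i" "j \<in> faces_of d i'"
      "k < num_dofs d" "l < num_dofs d" for i i' j k l
  proof -
    have j: "j < num_faces d"
      using that(3) by (simp add: faces_of_def)
    show ?thesis
      using sides(4)[OF j that(1)] sides(4)[OF j that(2)] that by (intro DMQ_symmetric[OF j]) auto
  qed
  have diagonal: "diagonal_block d \<nu> i $$ (k, l) = diagonal_block d \<nu> i $$ (l, k)"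
  proof -
    have "(\<Sum>j\<in>faces_of d i. DMQ d i j i $$ (k, l)) = (\<Sum>j\<in>faces_of d i. DMQ d i j i $$ (l, k))"
      using DMQ i kl by (intro sum.cong) auto
    then show ?thesis
      using kl by (simp add: diagonal_block_def M_elem_symmetric[OF kl])
  qed
  let ?S = "{j \<in> faces_of d i. neighbour d i j = i'}"
  have S: "?S = {j \<in> faces_of d i'. neighbour d i' j = i}"
    by (rule faces_with_neighbour[OF i])
  have "(\<Sum>j\<in>?S. DMQ d i j i' $$ (k, l)) = (\<Sum>j\<in>?S. DMQ d i' j i $$ (l, k))"
  proof (rule sum.cong)
    fix j
    assume j: "j \<in> ?S"
    with S have "j \<in> faces_of d i'"
      by blast
    with j show "DMQ d i j i' $$ (k, l) = DMQ d i' j i $$ (l, k)"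
      by (intro DMQ i kl) auto
  qed simp
  then show ?thesis
    using kl diagonal by (simp add: system_block_def S)
qed

end

text \<open>Unique existence keeps the symmetry claim from being vacuous: it concerns the one matrix
  that the system determines.\<close>

theorem corollary3:
  fixes d :: discretization and \<nu> :: real
  assumes "valid_mesh d"
    and "t_old d < t_new d"
    and "deg_time d = 0"
  shows "(\<exists>!A. coefficient_matrix d \<nu> A) \<and>
    (\<forall>A. coefficient_matrix d \<nu> A \<longrightarrow>
       A \<in> carrier_mat (num_elems d * num_basis (deg_space d)) (num_elems d * num_basis (deg_space d)) \<and>
       transpose_mat A = A)"
proof -
  interpret mesh_constant_in_time d
    by unfold_locales (fact assms)+
  let ?A = "block_mat (num_elems d) (num_dofs d) (system_block d \<nu>)"
  have "coefficient_matrix d \<nu> ?A"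
    by (rule coefficient_matrix_block_mat)
  moreover from this have "A = ?A" if "coefficient_matrix d \<nu> A" for A
    using coefficient_matrix_unique that by blast
  moreover have "?A \<in> carrier_mat (num_elems d * num_basis (deg_space d)) (num_elems d * num_basis (deg_space d))"
    by (simp add: block_mat_def num_dofs_eq)
  moreover have "transpose_mat ?A = ?A"
    by (intro transpose_block_mat system_block_symmetric)
  ultimately show ?thesis
    by metis
qed

end
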